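(* Let $U:\mathbb R^d\to\mathbb R$ be differentiable, strongly convex, with Lipschitz gradient, let $h,\gamma>0$, and let $\beta=e^{-\gamma h}$, $r=e^{-\gamma h/2}$, $\sigma=(1-\beta)^{1/2}$, $\varsigma=(1-\beta^2)^{1/2}$. Let $(X_k,V_k)_{k\ge0}$ denote the chain of the indicated splitting, with $\xi_{k+1}$ (for ABOBA), respectively $(\xi_{k+1}^{(1)},\xi_{k+1}^{(2)})$ in order of application (for AOBOA, BOAOB, OABAO), the standard Gaussian variables used in the $(k+1)$st step. The following identities hold. (i) ABOBA. The points $Y_{m+1}=X_m+\frac h2V_m$ ($m\ge0$), together with $Y_0:=X_0-\frac h2V_0$, satisfy $Y_{m+1}-Y_m=hV_m$ for $m\ge0$ and, for $m\ge1$, $$Y_{m+1}=Y_m+\beta(Y_m-Y_{m-1})-s\nabla U(Y_m)+h\varsigma\,\xi_m,\qquad s=\frac{h^2}{2}(1+\beta);$$ the noise variables $h\varsigma\xi_m$ are independent with covariance $h^2(1-\beta^2)\,\mathrm{Id}_d$. (ii) AOBOA. The points $Y_{m+1}=X_m+\frac h2V_m$ ($m\ge0$), together with $Y_0:=X_0-\frac h2V_0$, satisfy $Y_{m+1}-Y_m=hV_m$ for $m\ge0$ and, for $m\ge1$, $$Y_{m+1}=Y_m+\beta(Y_m-Y_{m-1})-s\nabla U(Y_m)+h\sigma\bigl(r\xi_m^{(1)}+\xi_m^{(2)}\bigr),\qquad s=\sqrt\beta\,h^2;$$ the noise variables are independent with covariance $h^2(1-\beta^2)\,\mathrm{Id}_d$.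 (iii) BOAOB. Let $\xi_0^{(2)}\sim\mathcal N(0,\mathrm{Id}_d)$ be independent of the variables driving the chain, or alternatively let $\xi_0^{(2)}$ be the zero vector, and define the auxiliary variable $X_{-1}$ by $$V_0=\frac rh(X_0-X_{-1})+\sigma\xi_0^{(2)}-\frac h2\nabla U(X_0).$$ Then, for $k\ge0$, $$X_{k+1}=X_k+\beta(X_k-X_{k-1})-s\nabla U(X_k)+h\sigma\bigl(r\xi_k^{(2)}+\xi_{k+1}^{(1)}\bigr),\qquad s=\sqrt\beta\,h^2;$$ the noise variables are independent. If $\xi_0^{(2)}\sim\mathcal N(0,\mathrm{Id}_d)$, every noise variable has covariance $h^2(1-\beta^2)\,\mathrm{Id}_d$; if $\xi_0^{(2)}=0$, the first has the smaller covariance $h^2(1-\beta)\,\mathrm{Id}_d$, and each subsequent one has covariance $h^2(1-\beta^2)\,\mathrm{Id}_d$. (iv) OABAO. Set $\chi_m=r\xi_{m-1}^{(2)}+\xi_m^{(1)}$ for $m\ge2$. The points $Y_m=X_{m-1}+\frac h2\bigl(rV_{m-1}+\sigma\xi_m^{(1)}\bigr)$ ($m\ge1$) satisfy, for $m\ge2$, $$Y_{m+1}=Y_m+\beta(Y_m-Y_{m-1})-s\nabla U(Y_m)+\frac h2\sigma\bigl(\chi_m+\chi_{m+1}\bigr),\qquad s=\frac{h^2}{2}(1+\beta).$$ The variables $\sigma\chi_m$, $m\ge2$, are independent $\mathcal N(0,(1-\beta^2)\mathrm{Id}_d)$, so the noise $\zeta_{m+1}=\frac h2\sigma(\chi_m+\chi_{m+1})$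 is a centered $1$-dependent Gaussian sequence with $\mathbb E[\zeta_k\zeta_k^\top]=\frac{h^2}{2}(1-\beta^2)\mathrm{Id}_d$ and $\mathbb E[\zeta_k\zeta_{k+1}^\top]=\frac{h^2}{4}(1-\beta^2)\mathrm{Id}_d$; in law it coincides with the sequence $\frac h2\varsigma(\eta_k+\eta_{k+1})$ where $(\eta_k)$ are i.i.d. $\mathcal N(0,\mathrm{Id}_d)$ (the stationary BAOAB noise).
   Context: Splittings. For $t>0$, define on $\mathbb R^d\times\mathbb R^d$ the maps $\mathrm A_t(x,v)=(x+tv,v)$, $\mathrm B_t(x,v)=(x,v-t\nabla U(x))$, $\mathrm O_t(x,v)=(x,e^{-\gamma t}v+(1-e^{-2\gamma t})^{1/2}\xi)$, where $\xi\sim\mathcal N(0,\mathrm{Id}_d)$ is drawn independently at each application of $\mathrm O_t$. One step with step size $h$ applies successively, in the order of the letters of the name: ABOBA: $\mathrm A_{h/2},\mathrm B_{h/2},\mathrm O_h,\mathrm B_{h/2},\mathrm A_{h/2}$; AOBOA: $\mathrm A_{h/2},\mathrm O_{h/2},\mathrm B_h,\mathrm O_{h/2},\mathrm A_{h/2}$; BOAOB: $\mathrm B_{h/2},\mathrm O_{h/2},\mathrm A_h,\mathrm O_{h/2},\mathrm B_{h/2}$; OABAO: $\mathrm O_{h/2},\mathrm A_{h/2},\mathrm B_h,\mathrm A_{h/2},\mathrm O_{h/2}$. The chain iterates these steps with all Gaussian variables independent. A sequence $(\zeta_k)$ is $1$-dependent if $(\zeta_i)_{i\le k}$ and $(\zeta_i)_{i\ge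 k+2}$ are independent for every $k$. *)

theory Defs
  imports "HOL-Probability.Probability"
begin

definition strongly_convex :: "('a::real_inner \<Rightarrow> real) \<Rightarrow> bool" where
  "strongly_convex f \<longleftrightarrow>
     (\<exists>\<mu>>0. \<forall>x y. \<forall>t\<in>{0..1}.
        f ((1 - t) *\<^sub>R x + t *\<^sub>R y)
          \<le> (1 - t) * f x + t * f y - \<mu> / 2 * t * (1 - t) * (norm (x - y))\<^sup>2)"

subsection \<open>The splitting maps\<close>

definition A_map :: "real \<Rightarrow> 'a \<times> 'a \<Rightarrow> ('a::real_vector) \<times> 'a" where
  "A_map t = (\<lambda>(x, v). (x + t *\<^sub>R v, v))"

definition B_map :: "('a \<Rightarrow> 'a) \<Rightarrow> real \<Rightarrow> 'a \<times> 'a \<Rightarrow> ('a::real_vector) \<times> 'a" where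
  "B_map gradU t = (\<lambda>(x, v). (x, v - t *\<^sub>R gradU x))"

text \<open>The Gaussian variable of an O-step is the explicit argument \<open>\<xi>\<close>.\<close>

definition O_map :: "real \<Rightarrow> real \<Rightarrow> 'a \<Rightarrow> 'a \<times> 'a \<Rightarrow> ('a::real_vector) \<times> 'a" where
  "O_map \<gamma> t \<xi> = (\<lambda>(x, v). (x, exp (- \<gamma> * t) *\<^sub>R v + sqrt (1 - exp (- 2 * \<gamma> * t)) *\<^sub>R \<xi>))"

text \<open>Letters are applied from left to right, so the compositions below read backwards;
  \<open>\<xi>\<^sub>1\<close> is used before \<open>\<xi>\<^sub>2\<close>.\<close>

definition ABOBA_step ::
    "('a \<Rightarrow> 'a) \<Rightarrow> real \<Rightarrow> real \<Rightarrow> 'a \<Rightarrow> 'a \<times> 'a \<Rightarrow> ('a::real_vector) \<times> 'a" where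
  "ABOBA_step gradU \<gamma> h \<xi> =
     A_map (h/2) \<circ> B_map gradU (h/2) \<circ> O_map \<gamma> h \<xi> \<circ> B_map gradU (h/2) \<circ> A_map (h/2)"

definition AOBOA_step ::
    "('a \<Rightarrow> 'a) \<Rightarrow> real \<Rightarrow> real \<Rightarrow> 'a \<Rightarrow> 'a \<Rightarrow> 'a \<times> 'a \<Rightarrow> ('a::real_vector) \<times> 'a" where
  "AOBOA_step gradU \<gamma> h \<xi>\<^sub>1 \<xi>\<^sub>2 =
     A_map (h/2) \<circ> O_map \<gamma> (h/2) \<xi>\<^sub>2 \<circ> B_map gradU h \<circ> O_map \<gamma> (h/2) \<xi>\<^sub>1 \<circ> A_map (h/2)"

definition BOAOB_step ::
    "('a \<Rightarrow> 'a) \<Rightarrow> real \<Rightarrow> real \<Rightarrow> 'a \<Rightarrow> 'a \<Rightarrow> 'a \<times> 'a \<Rightarrow> ('a::real_vector) \<times> 'a" where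
  "BOAOB_step gradU \<gamma> h \<xi>\<^sub>1 \<xi>\<^sub>2 =
     B_map gradU (h/2) \<circ> O_map \<gamma> (h/2) \<xi>\<^sub>2 \<circ> A_map h \<circ> O_map \<gamma> (h/2) \<xi>\<^sub>1 \<circ> B_map gradU (h/2)"

definition OABAO_step ::
    "('a \<Rightarrow> 'a) \<Rightarrow> real \<Rightarrow> real \<Rightarrow> 'a \<Rightarrow> 'a \<Rightarrow> 'a \<times> 'a \<Rightarrow> ('a::real_vector) \<times> 'a" where
  "OABAO_step gradU \<gamma> h \<xi>\<^sub>1 \<xi>\<^sub>2 =
     O_map \<gamma> (h/2) \<xi>\<^sub>2 \<circ> A_map (h/2) \<circ> B_map gradU h \<circ> A_map (h/2) \<circ> O_map \<gamma> (h/2) \<xi>\<^sub>1"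

subsection \<open>Gaussian vectors, covariance, independence\<close>

text \<open>Density of the normal law with mean \<open>0\<close> and covariance \<open>c\<close> times the identity, for \<open>c > 0\<close>.\<close>

definition iso_normal_density :: "real \<Rightarrow> real^'n \<Rightarrow> real" where
  "iso_normal_density c x =
     exp (- (norm x)\<^sup>2 / (2 * c)) / sqrt ((2 * pi * c) ^ CARD('n))"

definition iso_gaussian :: "'w measure \<Rightarrow> real \<Rightarrow> ('w \<Rightarrow> real^'n) \<Rightarrow> bool" where
  "iso_gaussian M c X \<longleftrightarrow> distributed M lborel X (\<lambda>x. ennreal (iso_normal_density c x))"

text \<open>Point masses count as (degenerate) normal laws.\<close>

definition real_gaussian :: "'w measure \<Rightarrow> ('w \<Rightarrow> real) \<Rightarrow> bool" where
  "real_gaussian M X \<longleftrightarrow>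
     (\<exists>\<mu> s. s > 0 \<and> distributed M lborel X (\<lambda>x. ennreal (normal_density \<mu> s x))) \<or>
     (\<exists>\<mu>. X \<in> borel_measurable M \<and> distr M borel X = return borel \<mu>)"

definition gaussian_sequence :: "'w measure \<Rightarrow> 'i set \<Rightarrow> ('i \<Rightarrow> 'w \<Rightarrow> real^'n) \<Rightarrow> bool" where
  "gaussian_sequence M I \<zeta> \<longleftrightarrow>
     (\<forall>F a. finite F \<and> F \<subseteq> I \<longrightarrow> real_gaussian M (\<lambda>\<omega>. \<Sum>k\<in>F. a k \<bullet> \<zeta> k \<omega>))"

text \<open>The matrix \<open>x y\<^sup>T\<close>.\<close>

definition outer :: "real^'n \<Rightarrow> real^'n \<Rightarrow> real^'n^'n" where
  "outer x y = columnvector x ** (rowvector y :: real^'n^1)"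

text \<open>Existence of the moments is part of the following two notions.\<close>

definition has_cross_moment ::
    "'w measure \<Rightarrow> ('w \<Rightarrow> real^'n) \<Rightarrow> ('w \<Rightarrow> real^'n) \<Rightarrow> real^'n^'n \<Rightarrow> bool" where
  "has_cross_moment M X Y C \<longleftrightarrow> has_bochner_integral M (\<lambda>\<omega>. outer (X \<omega>) (Y \<omega>)) C"

definition has_covariance :: "'w measure \<Rightarrow> ('w \<Rightarrow> real^'n) \<Rightarrow> real^'n^'n \<Rightarrow> bool" where
  "has_covariance M X C \<longleftrightarrow>
     (\<exists>\<mu>. has_bochner_integral M X \<mu> \<and> has_cross_moment M (\<lambda>\<omega>. X \<omega> - \<mu>) (\<lambda>\<omega>. X \<omega> - \<mu>) C)"

text \<open>Unlike \<^const>\<open>prob_space.indep_var\<close>, this allows the two random variables to have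
  different types.\<close>

definition indep_rv ::
    "'w measure \<Rightarrow> 'a measure \<Rightarrow> ('w \<Rightarrow> 'a) \<Rightarrow> 'b measure \<Rightarrow> ('w \<Rightarrow> 'b) \<Rightarrow> bool" where
  "indep_rv M S X T Y \<longleftrightarrow> X \<in> measurable M S \<and> Y \<in> measurable M T \<and>
     prob_space.indep_set M {X -` A \<inter> space M | A. A \<in> sets S} {Y -` B \<inter> space M | B. B \<in> sets T}"

definition indep_seq :: "'w measure \<Rightarrow> 'i set \<Rightarrow> ('i \<Rightarrow> 'w \<Rightarrow> real^'n) \<Rightarrow> bool" where
  "indep_seq M I \<zeta> \<longleftrightarrow> prob_space.indep_vars M (\<lambda>_. borel) \<zeta> I"

text \<open>The law of a family is taken on the product of the Borel spaces.\<close>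

abbreviation prod_borel :: "'i set \<Rightarrow> ('i \<Rightarrow> real^'n) measure" where
  "prod_borel I \<equiv> PiM I (\<lambda>_. borel)"

abbreviation joint :: "'i set \<Rightarrow> ('i \<Rightarrow> 'w \<Rightarrow> real^'n) \<Rightarrow> 'w \<Rightarrow> 'i \<Rightarrow> real^'n" where
  "joint I \<zeta> \<equiv> (\<lambda>\<omega>. \<lambda>k\<in>I. \<zeta> k \<omega>)"

definition one_dependent :: "'w measure \<Rightarrow> nat set \<Rightarrow> (nat \<Rightarrow> 'w \<Rightarrow> real^'n) \<Rightarrow> bool" where
  "one_dependent M I \<zeta> \<longleftrightarrow>
     (\<forall>k. indep_rv M
        (prod_borel {i\<in>I. i \<le> k}) (joint {i\<in>I. i \<le> k} \<zeta>)
        (prod_borel {i\<in>I. i \<ge> k + 2}) (joint {i\<in>I. i \<ge> k + 2} \<zeta>))"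

definition iid_std_gaussian :: "'w measure \<Rightarrow> 'i set \<Rightarrow> ('i \<Rightarrow> 'w \<Rightarrow> real^'n) \<Rightarrow> bool" where
  "iid_std_gaussian M I \<xi> \<longleftrightarrow> indep_seq M I \<xi> \<and> (\<forall>i\<in>I. iso_gaussian M 1 (\<xi> i))"

subsection \<open>The chains\<close>

text \<open>Step number \<open>k + 1\<close> uses the noise with index \<open>k + 1\<close>. For the schemes with two O-steps,
  \<open>\<xi> k 1\<close> and \<open>\<xi> k 2\<close> stand for \<open>\<xi>\<^sub>k\<^sup>(\<^sup>1\<^sup>)\<close> and \<open>\<xi>\<^sub>k\<^sup>(\<^sup>2\<^sup>)\<close>. The value \<open>\<xi> 0\<close> (respectively \<open>\<xi> 0 j\<close>)
  plays no role in the chain.\<close>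

definition chain1 ::
    "'w measure \<Rightarrow> (real^'n \<Rightarrow> (real^'n) \<times> (real^'n) \<Rightarrow> (real^'n) \<times> (real^'n)) \<Rightarrow>
     (nat \<Rightarrow> 'w \<Rightarrow> real^'n) \<Rightarrow> (nat \<Rightarrow> 'w \<Rightarrow> real^'n) \<Rightarrow> (nat \<Rightarrow> 'w \<Rightarrow> real^'n) \<Rightarrow> bool" where
  "chain1 M step \<xi> X V \<longleftrightarrow>
     iid_std_gaussian M {1..} \<xi> \<and>
     indep_rv M borel (\<lambda>\<omega>. (X 0 \<omega>, V 0 \<omega>)) (prod_borel {1..}) (joint {1..} \<xi>) \<and>
     (\<forall>k. \<forall>\<omega>\<in>space M. (X (Suc k) \<omega>, V (Suc k) \<omega>) = step (\<xi> (Suc k) \<omega>) (X k \<omega>, V k \<omega>))"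

definition noise_index :: "(nat \<times> nat) set" where
  "noise_index = {1..} \<times> {1, 2}"

definition chain2 ::
    "'w measure \<Rightarrow>
     (real^'n \<Rightarrow> real^'n \<Rightarrow> (real^'n) \<times> (real^'n) \<Rightarrow> (real^'n) \<times> (real^'n)) \<Rightarrow>
     (nat \<Rightarrow> nat \<Rightarrow> 'w \<Rightarrow> real^'n) \<Rightarrow> (nat \<Rightarrow> 'w \<Rightarrow> real^'n) \<Rightarrow> (nat \<Rightarrow> 'w \<Rightarrow> real^'n) \<Rightarrow> bool" where
  "chain2 M step \<xi> X V \<longleftrightarrow>
     iid_std_gaussian M noise_index (case_prod \<xi>) \<and>
     indep_rv M borel (\<lambda>\<omega>. (X 0 \<omega>, V 0 \<omega>))
       (prod_borel noise_index) (joint noise_index (case_prod \<xi>)) \<and>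
     (\<forall>k. \<forall>\<omega>\<in>space M. (X (Suc k) \<omega>, V (Suc k) \<omega>) =
        step (\<xi> (Suc k) 1 \<omega>) (\<xi> (Suc k) 2 \<omega>) (X k \<omega>, V k \<omega>))"

text \<open>The two admissible choices of the auxiliary variable \<open>\<xi> 0 2\<close>.\<close>

definition gaussian_start :: "'w measure \<Rightarrow> (nat \<Rightarrow> nat \<Rightarrow> 'w \<Rightarrow> real^'n) \<Rightarrow> bool" where
  "gaussian_start M \<xi> \<longleftrightarrow>
     iso_gaussian M 1 (\<xi> 0 2) \<and>
     indep_rv M borel (\<xi> 0 2) (prod_borel noise_index) (joint noise_index (case_prod \<xi>))"

definition zero_start :: "'w measure \<Rightarrow> (nat \<Rightarrow> nat \<Rightarrow> 'w \<Rightarrow> real^'n) \<Rightarrow> bool" where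
  "zero_start M \<xi> \<longleftrightarrow> (\<forall>\<omega>\<in>space M. \<xi> 0 2 \<omega> = 0)"

end

theory Submission
  imports Defs
begin

text \<open>
  Every splitting reads the gradient at one new point per step. Along these points the velocity
  can be expressed through the increment of the position and the noise, and so be eliminated; this
  turns the chain into a heavy-ball recursion with momentum \<open>\<beta>\<close>. The four recursions (\<open>ABOBA_recursion\<close>,
  \<open>AOBOA_recursion\<close>, \<open>BOAOB_recursion\<close>, \<open>OABAO_recursion\<close>) are identities between vectors that
  hold along every single path.

  What is left is the law of the noise. An isotropic Gaussian vector is the same thing as a vector
  with independent centered normal coordinates of equal variance
  (\<open>iso_gaussian_iff_coordinates\<close>), and independence of the vectors together with independence of
  the coordinates of each of them gives independence of all coordinates at once
  (\<open>indep_vars_nested\<close>, \<open>indep_vars_coordinates\<close>). All statements about variances, covariances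
  and Gaussianity therefore reduce to sums of independent real normal variables. In particular
  \<open>r \<xi> + \<xi>'\<close> has variance \<open>1 + r\<^sup>2 = 1 + \<beta>\<close>, and \<open>\<sigma>\<^sup>2 (1 + \<beta>) = 1 - \<beta>\<^sup>2\<close>. For AOBOA and
  BOAOB different steps use disjoint pairs of Gaussian variables, which makes the noise independent;
  for BOAOB the auxiliary variable \<open>\<xi>\<^sub>0\<^sup>(\<^sup>2\<^sup>)\<close>, Gaussian or zero, is first adjoined to the
  independent family (\<open>indep_vars_insert_indep_rv\<close>).

  For OABAO the white noise \<open>\<sigma> \<chi>\<^sub>m\<close> enters two successive steps, because the gradient
  is read between two half drifts whose velocities both carry it. The noise is thus a moving average
  of length two of independent Gaussian vectors, and everything claimed about it holds for any such
  moving average (locale \<open>moving_average\<close>). Its law depends on the weight and on the variance of the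
  white noise alone, so it agrees with the law of the moving average built from another white noise of
  the same variance.
\<close>

section \<open>Isotropic Gaussian vectors as families of independent coordinates\<close>

lemma borel_measurable_vec_lambda:
  "(vec_lambda :: _ \<Rightarrow> real^'n) \<in> borel_measurable (PiM UNIV (\<lambda>_. borel))"
proof -
  have "(\<lambda>f. \<Sum>i\<in>UNIV. f i *\<^sub>R axis i 1 :: real^'n) \<in> borel_measurable (PiM UNIV (\<lambda>_. borel))"
    by measurable
  moreover have "(\<lambda>f. \<Sum>i\<in>UNIV. f i *\<^sub>R axis i 1 :: real^'n) = vec_lambda"
    by (auto simp: vec_eq_iff axis_def if_distrib[of "\<lambda>x. _ * x"] cong: if_cong)
  ultimately show ?thesis by simp
qed

lemma borel_measurable_vec_nth [measurable]: "(\<lambda>x::real^'n. x $ i) \<in> borel_measurable borel"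
  by (intro borel_measurable_continuous_onI continuous_intros)

text \<open>Lebesgue measure is characterised by its values on boxes, and the two sides agree there. Combined
  with the product formula for the density, this makes the coordinates of a Gaussian vector
  independent.\<close>

lemma lborel_eq_distr_PiM:
  "(lborel :: (real^'n) measure) = distr (PiM UNIV (\<lambda>_. lborel)) borel vec_lambda"
proof (rule lborel_eqI)
  interpret product_sigma_finite "\<lambda>_::'n. lborel :: real measure"
    by standard
  have [measurable]: "(vec_lambda :: _ \<Rightarrow> real^'n) \<in> borel_measurable (PiM UNIV (\<lambda>_. lborel))"
    using borel_measurable_vec_lambda by (simp cong: measurable_cong_sets sets_PiM_cong)
  fix l u :: "real^'n"
  assume le: "\<And>b. b \<in> Basis \<Longrightarrow> l \<bullet> b \<le> u \<bullet> b"
  then have le': "l $ i \<le> u $ i" for i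
    by (metis axis_in_Basis_iff inner_axis mult.right_neutral one_index real_inner_1_right Basis_real_def insertI1)
  have "vec_lambda -` box l u \<inter> space (PiM UNIV (\<lambda>_::'n. lborel :: real measure))
      = Pi\<^sub>E UNIV (\<lambda>i. {l$i<..<u$i})"
    by (auto simp: space_PiM mem_box_cart PiE_iff)
  then have "emeasure (distr (PiM UNIV (\<lambda>_. lborel)) borel vec_lambda) (box l u)
      = (\<Prod>i\<in>UNIV. ennreal (u$i - l$i))"
    by (simp add: emeasure_distr emeasure_PiM le')
  also have "\<dots> = ennreal (\<Prod>i\<in>UNIV. u$i - l$i)"
    by (simp add: prod_ennreal le')
  also have "(\<Prod>i\<in>UNIV. u$i - l$i) = (\<Prod>b\<in>Basis. (u - l) \<bullet> b)"
    unfolding Basis_vec_def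
    by (simp add: prod.UNION_disjoint inner_axis axis_eq_axis prod.reindex inj_on_def)
  finally show "emeasure (distr (PiM UNIV (\<lambda>_. lborel)) borel vec_lambda) (box l u)
      = (\<Prod>b\<in>Basis. (u - l) \<bullet> b)" .
qed simp

lemma PiM_density:
  fixes f :: "'i \<Rightarrow> 'a \<Rightarrow> ennreal"
  assumes "finite I" and sf: "\<And>i. sigma_finite_measure (N i)"
    and f: "\<And>i. f i \<in> borel_measurable (N i)"
    and sfd: "\<And>i. sigma_finite_measure (density (N i) (f i))"
  shows "density (PiM I N) (\<lambda>x. \<Prod>i\<in>I. f i (x i)) = PiM I (\<lambda>i. density (N i) (f i))"
proof -
  interpret N: product_sigma_finite N using sf by (simp add: product_sigma_finite_def)
  interpret D: product_sigma_finite "\<lambda>i. density (N i) (f i)" using sfd by (simp add: product_sigma_finite_def)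
  note [measurable] = f
  show ?thesis
  proof (rule D.PiM_eqI)
    show "sets (density (PiM I N) (\<lambda>x. \<Prod>i\<in>I. f i (x i))) = sets (PiM I (\<lambda>i. density (N i) (f i)))"
      by (simp cong: sets_PiM_cong)
    fix A assume "\<And>i. i \<in> I \<Longrightarrow> A i \<in> sets (density (N i) (f i))"
    then have A [measurable]: "\<And>i. i \<in> I \<Longrightarrow> A i \<in> sets (N i)" by simp
    have [measurable]: "Pi\<^sub>E I A \<in> sets (PiM I N)"
      using A \<open>finite I\<close> by (intro sets_PiM_I_finite)
    have "emeasure (density (PiM I N) (\<lambda>x. \<Prod>i\<in>I. f i (x i))) (Pi\<^sub>E I A)
        = (\<integral>\<^sup>+x. (\<Prod>i\<in>I. f i (x i)) * indicator (Pi\<^sub>E I A) x \<partial>PiM I N)"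
      by (subst emeasure_density) auto
    also have "\<dots> = (\<integral>\<^sup>+x. (\<Prod>i\<in>I. f i (x i) * indicator (A i) (x i)) \<partial>PiM I N)"
    proof (rule nn_integral_cong)
      fix x assume "x \<in> space (PiM I N)"
      then have "indicator (Pi\<^sub>E I A) x = (\<Prod>i\<in>I. indicator (A i) (x i) :: ennreal)"
        using \<open>finite I\<close>
        by (auto simp: indicator_def space_PiM PiE_iff intro!: prod.neutral[symmetric] bexI)
      then show "(\<Prod>i\<in>I. f i (x i)) * indicator (Pi\<^sub>E I A) x = (\<Prod>i\<in>I. f i (x i) * indicator (A i) (x i))"
        by (simp add: prod.distrib)
    qed
    also have "\<dots> = (\<Prod>i\<in>I. emeasure (density (N i) (f i)) (A i))"
      using \<open>finite I\<close> by (subst N.product_nn_integral_prod) (auto simp: emeasure_density intro!: prod.cong)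
    finally show "emeasure (density (PiM I N) (\<lambda>x. \<Prod>i\<in>I. f i (x i))) (Pi\<^sub>E I A)
        = (\<Prod>i\<in>I. emeasure (density (N i) (f i)) (A i))" .
  qed fact
qed

lemma iso_normal_density_eq_prod:
  fixes x :: "real^'n"
  assumes "c > 0"
  shows "iso_normal_density c x = (\<Prod>i\<in>UNIV. normal_density 0 (sqrt c) (x $ i))"
proof -
  have "(norm x)\<^sup>2 = (\<Sum>i\<in>UNIV. (x $ i)\<^sup>2)"
    by (simp add: power2_norm_eq_inner inner_vec_def) (simp add: power2_eq_square)
  moreover have "sqrt ((2 * pi * c) ^ CARD('n)) = sqrt (2 * pi * c) ^ CARD('n)"
    by (simp add: real_sqrt_power)
  ultimately show ?thesis
    using assms
    by (simp add: iso_normal_density_def normal_density_def prod.distrib prod_dividef exp_sum[symmetric]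
        sum_divide_distrib sum_negf power_divide)
qed

text \<open>The centered normal law with variance \<open>c\<close>. Note that the parameter is the variance, as in
  \<^const>\<open>iso_normal_density\<close>, whereas \<^const>\<open>normal_density\<close> takes the standard deviation.\<close>

definition normal_measure :: "real \<Rightarrow> real measure" where
  "normal_measure c = density lborel (normal_density 0 (sqrt c))"

lemma sets_normal_measure [simp, measurable_cong]: "sets (normal_measure c) = sets borel"
  by (simp add: normal_measure_def)

lemma prob_space_normal_measure: "c > 0 \<Longrightarrow> prob_space (normal_measure c)"
  unfolding normal_measure_def by (rule prob_space_normal_density) simp

lemma density_iso_normal_eq_distr_PiM:
  assumes "c > 0"
  shows "density lborel (iso_normal_density c :: real^'n \<Rightarrow> real)
      = distr (PiM UNIV (\<lambda>_. normal_measure c)) borel vec_lambda"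
proof -
  have [measurable]: "(vec_lambda :: _ \<Rightarrow> real^'n) \<in> borel_measurable (PiM UNIV (\<lambda>_. lborel))"
    using borel_measurable_vec_lambda by (simp cong: measurable_cong_sets sets_PiM_cong)
  have [measurable]: "(iso_normal_density c :: real^'n \<Rightarrow> real) \<in> borel_measurable borel"
    unfolding iso_normal_density_def by measurable
  have "density lborel (iso_normal_density c :: real^'n \<Rightarrow> real)
      = distr (density (PiM UNIV (\<lambda>_. lborel)) (\<lambda>f. iso_normal_density c (vec_lambda f :: real^'n))) borel vec_lambda"
    unfolding lborel_eq_distr_PiM by (subst density_distr) auto
  also have "(\<lambda>f. ennreal (iso_normal_density c (vec_lambda f :: real^'n)))
      = (\<lambda>f. \<Prod>i\<in>UNIV. ennreal (normal_density 0 (sqrt c) (f i)))"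
    using assms by (simp add: iso_normal_density_eq_prod prod_ennreal)
  also have "density (PiM UNIV (\<lambda>_::'n. lborel)) \<dots> = PiM UNIV (\<lambda>_. normal_measure c)"
    unfolding normal_measure_def
    using prob_space_normal_measure[OF assms] assms
    by (intro PiM_density)
       (auto simp: normal_measure_def prob_space_imp_sigma_finite intro: lborel.sigma_finite_measure_axioms)
  finally show ?thesis .
qed

lemma iso_gaussian_iff_distr:
  "iso_gaussian M c (X :: 'w \<Rightarrow> real^'n) \<longleftrightarrow>
    X \<in> borel_measurable M \<and> distr M borel X = density lborel (iso_normal_density c)"
proof -
  have "(iso_normal_density c :: real^'n \<Rightarrow> real) \<in> borel_measurable borel"
    unfolding iso_normal_density_def by measurable
  moreover have "distr M borel X = distr M lborel X"
    by (rule distr_cong) auto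
  ultimately show ?thesis
    unfolding iso_gaussian_def distributed_def by (auto simp: measurable_lborel1)
qed

lemma distributed_normal_iff_distr:
  "distributed M lborel (Z :: 'w \<Rightarrow> real) (normal_density 0 (sqrt c)) \<longleftrightarrow>
    Z \<in> borel_measurable M \<and> distr M borel Z = normal_measure c"
proof -
  have "distr M borel Z = distr M lborel Z"
    by (rule distr_cong) auto
  then show ?thesis
    unfolding distributed_def normal_measure_def by auto
qed

text \<open>Both sides say that the law of \<open>X\<close> is the image of a product of normal laws under
  \<^const>\<open>vec_lambda\<close>: the left one by the factorisation of the density, the right one because
  independence means that the joint law is the product of the marginals.\<close>

lemma (in prob_space) iso_gaussian_iff_coordinates:
  fixes X :: "'a \<Rightarrow> real^'n"
  assumes "c > 0"
  shows "iso_gaussian M c X \<longleftrightarrow>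
    indep_vars (\<lambda>_. borel) (\<lambda>i \<omega>. X \<omega> $ i) UNIV \<and>
    (\<forall>i. distributed M lborel (\<lambda>\<omega>. X \<omega> $ i) (normal_density 0 (sqrt c)))"
    (is "?G \<longleftrightarrow> ?I \<and> ?D")
proof
  let ?P = "PiM UNIV (\<lambda>_::'n. borel :: real measure)"
  let ?N = "PiM UNIV (\<lambda>_::'n. normal_measure c)"
  have setsN [measurable_cong]: "sets ?N = sets ?P" by (intro sets_PiM_cong) auto
  note [measurable] = borel_measurable_vec_lambda
  { assume ?G
    then have X [measurable]: "X \<in> borel_measurable M"
      and dX: "distr M borel X = distr ?N borel vec_lambda"
      using density_iso_normal_eq_distr_PiM[OF assms] by (auto simp: iso_gaussian_iff_distr)
    have d: "distr M borel (\<lambda>\<omega>. X \<omega> $ i) = normal_measure c" for i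
    proof -
      have "distr M borel (\<lambda>\<omega>. X \<omega> $ i) = distr (distr M borel X) borel (\<lambda>x. x $ i)"
        by (simp add: distr_distr comp_def)
      also have "\<dots> = distr ?N borel (\<lambda>f. f i)"
        unfolding dX by (subst distr_distr) (auto simp: comp_def)
      also have "\<dots> = distr ?N (normal_measure c) (\<lambda>f. f i)"
        by (rule distr_cong) auto
      also have "\<dots> = normal_measure c"
        using prob_space_normal_measure[OF assms] by (intro distr_PiM_component) auto
      finally show ?thesis .
    qed
    have "distr M ?P (\<lambda>\<omega>. \<lambda>i\<in>UNIV. X \<omega> $ i) = distr (distr M borel X) ?P (\<lambda>x. \<lambda>i\<in>UNIV. x $ i)"
      by (subst distr_distr) (auto simp: comp_def intro!: measurable_restrict)
    also have "\<dots> = distr ?N ?P (\<lambda>f. f)"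
      unfolding dX by (subst distr_distr) (auto simp: comp_def fun_eq_iff intro!: measurable_restrict distr_cong)
    also have "\<dots> = ?N"
      using setsN by (intro distr_id2) auto
    finally have ?I
      by (subst indep_vars_iff_distr_eq_PiM) (auto simp: d)
    with d show "?I \<and> ?D"
      by (auto simp: distributed_normal_iff_distr) }
  { assume "?I \<and> ?D"
    then have I: ?I and d: "\<And>i. distr M borel (\<lambda>\<omega>. X \<omega> $ i) = normal_measure c"
      and [measurable]: "\<And>i. (\<lambda>\<omega>. X \<omega> $ i) \<in> borel_measurable M"
      by (auto simp: distributed_normal_iff_distr)
    have "(\<lambda>\<omega>. vec_lambda (\<lambda>i\<in>UNIV. X \<omega> $ i)) \<in> borel_measurable M"
      by measurable
    then have X [measurable]: "X \<in> borel_measurable M" by (simp add: restrict_def vec_lambda_eta)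
    have "distr M ?P (\<lambda>\<omega>. \<lambda>i\<in>UNIV. X \<omega> $ i) = ?N"
      using I by (subst (asm) indep_vars_iff_distr_eq_PiM) (auto simp: d)
    then have "distr ?N borel (vec_lambda :: _ \<Rightarrow> real^'n) = distr (distr M ?P (\<lambda>\<omega>. \<lambda>i\<in>UNIV. X \<omega> $ i)) borel vec_lambda"
      by simp
    also have "\<dots> = distr M borel X"
      by (subst distr_distr) (auto simp: comp_def vec_eq_iff intro!: measurable_restrict distr_cong)
    finally show ?G
      using density_iso_normal_eq_distr_PiM[OF assms, where 'n='n] by (simp add: iso_gaussian_iff_distr) }
qed

lemma iso_gaussian_cong:
  assumes "\<And>\<omega>. \<omega> \<in> space M \<Longrightarrow> X \<omega> = Y \<omega>"
  shows "iso_gaussian M c X \<longleftrightarrow> iso_gaussian M c Y"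
  using assms unfolding iso_gaussian_iff_distr
  by (intro conj_cong measurable_cong arg_cong2[where f="(=)"] distr_cong) auto

section \<open>Independence of blocks\<close>

lemma Int_stable_preimages: "Int_stable {f -` A \<inter> M | A. A \<in> sets N}"
proof (rule Int_stableI, clarify)
  fix A B assume "A \<in> sets N" "B \<in> sets N"
  then show "\<exists>C. f -` A \<inter> M \<inter> (f -` B \<inter> M) = f -` C \<inter> M \<and> C \<in> sets N"
    by (intro exI[of _ "A \<inter> B"]) auto
qed

lemma (in prob_space) indep_vars_cong_on_space:
  assumes "\<And>i \<omega>. i \<in> I \<Longrightarrow> \<omega> \<in> space M \<Longrightarrow> X i \<omega> = Y i \<omega>"
  shows "indep_vars N X I \<longleftrightarrow> indep_vars N Y I"
proof -
  have "X i -` A \<inter> space M = Y i -` A \<inter> space M" if "i \<in> I" for i A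
    using assms[OF that] by auto
  moreover have "X i \<in> measurable M (N i) \<longleftrightarrow> Y i \<in> measurable M (N i)" if "i \<in> I" for i
    using assms[OF that] by (intro measurable_cong)
  ultimately show ?thesis
    unfolding indep_vars_def2 by (intro conj_cong ball_cong indep_sets_cong refl) auto
qed

lemma (in prob_space) indep_vars_reindex_inj:
  assumes indep: "indep_vars N X (f ` I)" and inj: "inj_on f I"
  shows "indep_vars (\<lambda>i. N (f i)) (\<lambda>i. X (f i)) I"
  unfolding indep_vars_def2
proof (intro conjI ballI indep_setsI)
  let ?F = "\<lambda>k. {X k -` A \<inter> space M | A. A \<in> sets (N k)}"
  show rv: "X (f i) \<in> measurable M (N (f i))" if "i \<in> I" for i
    using indep that by (auto simp: indep_vars_def2)
  show "?F (f i) \<subseteq> events" if "i \<in> I" for i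
    using rv[OF that] by (auto intro: measurable_sets)
  fix A J
  assume J: "J \<noteq> {}" "J \<subseteq> I" "finite J" and A: "\<forall>i\<in>J. A i \<in> ?F (f i)"
  have injJ: "inj_on f J"
    using inj J by (rule_tac inj_on_subset)
  have "prob (\<Inter>k\<in>f ` J. A (inv_into J f k)) = (\<Prod>k\<in>f ` J. prob (A (inv_into J f k)))"
  proof (rule indep_setsD)
    show "indep_sets ?F (f ` I)"
      using indep by (simp add: indep_vars_def2)
    show "\<forall>k\<in>f ` J. A (inv_into J f k) \<in> ?F k"
      using A injJ by simp
  qed (use J in auto)
  then show "prob (\<Inter>i\<in>J. A i) = (\<Prod>i\<in>J. prob (A i))"
    using injJ by (simp add: prod.reindex)
qed

text \<open>Independence inside blocks combines with independence between blocks. The blocks are represented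
  by families \<open>S l\<close> of events that are stable under intersection, and not by random variables,
  so that blocks with values in different spaces can be treated together. For finitely many events,
  those in one block intersect to an event of \<open>S l\<close>; the probability factorises first over the
  blocks and then inside each of them.\<close>

lemma (in prob_space) indep_vars_nested:
  assumes S: "indep_sets S L"
    and Int: "\<And>l. l \<in> L \<Longrightarrow> Int_stable (S l)"
    and disj: "disjoint_family_on K L"
    and inner: "\<And>l. l \<in> L \<Longrightarrow> indep_vars N g (K l)"
    and S_g: "\<And>l k A. l \<in> L \<Longrightarrow> k \<in> K l \<Longrightarrow> A \<in> sets (N k) \<Longrightarrow> g k -` A \<inter> space M \<in> S l"
  shows "indep_vars N g (\<Union>l\<in>L. K l)"
  unfolding indep_vars_def2
proof (intro conjI ballI indep_setsI)
  let ?F = "\<lambda>k. {g k -` A \<inter> space M | A. A \<in> sets (N k)}"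
  show rv: "g k \<in> measurable M (N k)" if "k \<in> (\<Union>l\<in>L. K l)" for k
    using that inner by (auto simp: indep_vars_def2)
  show "?F k \<subseteq> events" if "k \<in> (\<Union>l\<in>L. K l)" for k
    using rv[OF that] by (auto intro: measurable_sets)
  fix A J
  assume J: "J \<noteq> {}" "J \<subseteq> (\<Union>l\<in>L. K l)" "finite J" and A: "\<forall>k\<in>J. A k \<in> ?F k"
  \<comment> \<open>Only finitely many blocks are met by \<open>J\<close>.\<close>
  define L' where "L' = {l \<in> L. J \<inter> K l \<noteq> {}}"
  have J_eq: "J = (\<Union>l\<in>L'. J \<inter> K l)"
    using J(2) unfolding L'_def by blast
  have "L' \<noteq> {}" "L' \<subseteq> L"
    using J unfolding L'_def by blast+
  have disj': "K l \<inter> K l' = {}" if "l \<in> L'" "l' \<in> L'" "l \<noteq> l'" for l l'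
    using disj that by (auto simp: disjoint_family_on_def L'_def)
  have "finite L'"
  proof (rule inj_on_finite)
    show "inj_on (\<lambda>l. J \<inter> K l) L'"
      using disj' unfolding L'_def by (intro inj_onI) blast
    show "(\<lambda>l. J \<inter> K l) ` L' \<subseteq> Pow J" "finite (Pow J)"
      using J by auto
  qed
  have block: "(\<Inter>k\<in>J \<inter> K l. A k) \<in> S l" if "l \<in> L'" for l
  proof -
    have l: "l \<in> L" using that \<open>L' \<subseteq> L\<close> by auto
    have sub: "A k \<in> S l" if "k \<in> J \<inter> K l" for k
      using A S_g[OF l] that by auto
    have "(\<Inter>k\<in>B. A k) \<in> S l" if "finite B" "B \<noteq> {}" "B \<subseteq> J \<inter> K l" for B
      using that
    proof (induction B rule: finite_ne_induct)
      case (insert k B)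
      then show ?case
        using Int[OF l] sub[of k] by (auto simp: Int_stable_def)
    qed (use sub in auto)
    then show ?thesis
      using that J by (auto simp: L'_def)
  qed
  have "prob (\<Inter>k\<in>J. A k) = prob (\<Inter>l\<in>L'. \<Inter>k\<in>J \<inter> K l. A k)"
    by (subst J_eq) (auto intro!: arg_cong[where f=prob])
  also have "\<dots> = (\<Prod>l\<in>L'. prob (\<Inter>k\<in>J \<inter> K l. A k))"
    using block \<open>finite L'\<close> \<open>L' \<noteq> {}\<close> \<open>L' \<subseteq> L\<close> by (intro indep_setsD[OF S]) auto
  also have "\<dots> = (\<Prod>l\<in>L'. \<Prod>k\<in>J \<inter> K l. prob (A k))"
  proof (rule prod.cong[OF refl])
    fix l assume l: "l \<in> L'"
    then have "indep_sets ?F (K l)"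
      using inner[of l] \<open>L' \<subseteq> L\<close> by (auto simp: indep_vars_def2)
    then show "prob (\<Inter>k\<in>J \<inter> K l. A k) = (\<Prod>k\<in>J \<inter> K l. prob (A k))"
      using l A J by (intro indep_setsD) (auto simp: L'_def)
  qed
  also have "\<dots> = (\<Prod>k\<in>(\<Union>l\<in>L'. J \<inter> K l). prob (A k))"
    using \<open>finite L'\<close> J disj' by (intro prod.UNION_disjoint[symmetric]) auto
  finally show "prob (\<Inter>k\<in>J. A k) = (\<Prod>k\<in>J. prob (A k))"
    using J_eq by simp
qed

lemma (in prob_space) indep_vars_singleton:
  "indep_vars N X {i} \<longleftrightarrow> X i \<in> measurable M (N i)"
  by (auto simp: indep_vars_def2 indep_sets_def subset_singleton_iff intro: measurable_sets)

lemma (in prob_space) indep_vars_pairs: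
  assumes indep: "indep_vars (\<lambda>_. borel) \<xi> I"
    and ab: "\<And>l. l \<in> L \<Longrightarrow> a l \<in> I \<and> b l \<in> I"
    and disj: "disjoint_family_on (\<lambda>l. {a l, b l}) L"
    and f: "(\<lambda>(x, y). f x y) \<in> borel \<Otimes>\<^sub>M borel \<rightarrow>\<^sub>M N"
  shows "indep_vars (\<lambda>_. N) (\<lambda>l \<omega>. f (\<xi> (a l) \<omega>) (\<xi> (b l) \<omega>)) L"
proof -
  have "indep_vars (\<lambda>l. PiM {a l, b l} (\<lambda>_. borel)) (\<lambda>l \<omega>. restrict (\<lambda>i. \<xi> i \<omega>) {a l, b l}) L"
    using ab disj by (intro indep_vars_restrict[OF indep]) auto
  then have "indep_vars (\<lambda>_. N) (\<lambda>l \<omega>. (\<lambda>g. (\<lambda>(x, y). f x y) (g (a l), g (b l)))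
      (restrict (\<lambda>i. \<xi> i \<omega>) {a l, b l})) L"
    by (rule indep_vars_compose2)
       (intro measurable_compose[OF _ f] measurable_Pair measurable_component_singleton; simp)
  then show ?thesis by simp
qed

text \<open>The hypothesis is independence of \<open>X a\<close> from the whole family as one random variable with
  values in a product space; the conclusion makes \<open>X a\<close> just one more member of the family. This is
  how the auxiliary variable at time zero joins the noise that drives the chain.\<close>

lemma (in prob_space) indep_vars_insert_indep_rv:
  fixes X :: "'i \<Rightarrow> 'a \<Rightarrow> real^'n"
  assumes indep: "indep_vars (\<lambda>_. borel) X I"
    and a: "indep_rv M borel (X a) (prod_borel I) (joint I X)" "a \<notin> I"
  shows "indep_vars (\<lambda>_. borel) X (insert a I)"
proof -
  let ?A = "{X a -` A \<inter> space M | A. A \<in> sets borel}"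
  let ?B = "{joint I X -` B \<inter> space M | B. B \<in> sets (prod_borel I)}"
  have "indep_vars (\<lambda>_. borel) X (\<Union>l\<in>UNIV. case_bool {a} I l)"
  proof (rule indep_vars_nested)
    show "indep_sets (case_bool ?A ?B) UNIV"
      using a(1) by (simp add: indep_rv_def indep_set_def)
    show "Int_stable (case_bool ?A ?B l)" for l
      using Int_stable_preimages[of "X a" "space M" borel]
        Int_stable_preimages[of "joint I X" "space M" "prod_borel I"]
      by (cases l) auto
    show "disjoint_family_on (case_bool {a} I) UNIV"
      using a(2) by (auto simp: disjoint_family_on_def split: bool.splits)
    show "indep_vars (\<lambda>_. borel) X (case_bool {a} I l)" for l
      using indep a(1) by (cases l) (auto simp: indep_vars_singleton indep_rv_def)
    fix l k and A :: "(real^'n) set"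
    assume k: "k \<in> case_bool {a} I l" and A: "A \<in> sets borel"
    show "X k -` A \<inter> space M \<in> case_bool ?A ?B l"
    proof (cases l)
      case False
      with k have "k \<in> I" by simp
      then have "(\<lambda>f. f k) -` A \<inter> space (prod_borel I) \<in> sets (prod_borel I)"
        using A by (intro measurable_sets[OF measurable_component_singleton])
      moreover have "X k -` A \<inter> space M
          = joint I X -` ((\<lambda>f. f k) -` A \<inter> space (prod_borel I)) \<inter> space M"
        using \<open>k \<in> I\<close> by (auto simp: space_PiM)
      ultimately show ?thesis
        using False by (simp only: bool.case) blast
    qed (use k A in auto)
  qed
  then show ?thesis by (simp add: UNIV_bool)
qed

text \<open>The only events generated by a constant are the empty one and the whole space. This covers the vanishing
  auxiliary variable, and families with an empty index set.\<close>

lemma (in prob_space) indep_rv_const: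
  assumes X: "\<And>\<omega>. \<omega> \<in> space M \<Longrightarrow> X \<omega> = x" "x \<in> space S" and Y: "Y \<in> measurable M T"
  shows "indep_rv M S X T Y"
proof -
  have pre: "X -` A \<inter> space M = (if x \<in> A then space M else {})" for A
    using X(1) by auto
  have "X \<in> measurable M S"
    using X by (subst measurable_cong[where g="\<lambda>_. x"]) auto
  moreover have "indep_set {X -` A \<inter> space M | A. A \<in> sets S} {Y -` B \<inter> space M | B. B \<in> sets T}"
  proof (rule indep_setI)
    show "{X -` A \<inter> space M | A. A \<in> sets S} \<subseteq> events"
      by (auto simp: pre)
    show "{Y -` B \<inter> space M | B. B \<in> sets T} \<subseteq> events"
      using Y by (auto intro: measurable_sets)
    fix a b assume "a \<in> {X -` A \<inter> space M | A. A \<in> sets S}" "b \<in> {Y -` B \<inter> space M | B. B \<in> sets T}"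
    then have "a = {} \<or> a = space M" "space M \<inter> b = b"
      by (auto simp: pre split: if_splits)
    then show "prob (a \<inter> b) = prob a * prob b"
      by (auto simp: prob_space)
  qed
  ultimately show ?thesis using Y by (simp add: indep_rv_def)
qed

lemma (in prob_space) indep_rv_of_indep_var:
  assumes indep: "indep_var S X T Y"
    and eq: "\<And>\<omega>. \<omega> \<in> space M \<Longrightarrow> X' \<omega> = X \<omega>" "\<And>\<omega>. \<omega> \<in> space M \<Longrightarrow> Y' \<omega> = Y \<omega>"
  shows "indep_rv M S X' T Y'"
proof -
  have "indep_vars (case_bool S T) (case_bool X' Y') UNIV"
    using indep unfolding indep_var_def
    by (rule indep_vars_cong_on_space[THEN iffD1, rotated]) (auto simp: eq split: bool.split)
  moreover have "(\<lambda>i. {case_bool X' Y' i -` A \<inter> space M |A. A \<in> sets (case_bool S T i)})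
    = case_bool {X' -` A \<inter> space M | A. A \<in> sets S} {Y' -` B \<inter> space M | B. B \<in> sets T}"
    by (rule ext) (auto split: bool.split)
  ultimately show ?thesis
    by (auto simp: indep_rv_def indep_vars_def2 indep_set_def UNIV_bool)
qed

lemma (in prob_space) indep_vars_coordinates:
  fixes X :: "'i \<Rightarrow> 'a \<Rightarrow> real^'n"
  assumes indep: "indep_vars (\<lambda>_. borel) X I"
    and gauss: "\<And>i. i \<in> I \<Longrightarrow> iso_gaussian M c (X i)" and "c > 0"
  shows "indep_vars (\<lambda>_. borel) (\<lambda>(i, j) \<omega>. X i \<omega> $ j) (I \<times> UNIV)"
proof -
  have "indep_vars (\<lambda>_. borel) (\<lambda>(i, j) \<omega>. X i \<omega> $ j) (\<Union>i\<in>I. {i} \<times> UNIV)"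
  proof (rule indep_vars_nested)
    show "indep_sets (\<lambda>i. {X i -` A \<inter> space M | A. A \<in> sets borel}) I"
      using indep by (simp add: indep_vars_def2)
    show "disjoint_family_on (\<lambda>i. {i} \<times> UNIV) I"
      by (auto simp: disjoint_family_on_def)
    show "Int_stable {X i -` A \<inter> space M | A. A \<in> sets borel}" for i
      by (rule Int_stable_preimages)
  next
    fix i assume "i \<in> I"
    then have "indep_vars (\<lambda>_. borel) (\<lambda>j \<omega>. X i \<omega> $ j) UNIV"
      using gauss \<open>c > 0\<close> by (simp add: iso_gaussian_iff_coordinates)
    then have "indep_vars (\<lambda>_. borel) (\<lambda>p \<omega>. X i \<omega> $ snd p) ({i} \<times> UNIV)"
      by (intro indep_vars_reindex_inj[where f=snd and X="\<lambda>j \<omega>. X i \<omega> $ j"])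
         (auto intro: inj_onI)
    then show "indep_vars (\<lambda>_. borel) (\<lambda>(i, j) \<omega>. X i \<omega> $ j) ({i} \<times> UNIV)"
      by (rule indep_vars_cong[THEN iffD1, rotated -1]) auto
  next
    fix i k and A :: "real set"
    assume "i \<in> I" "k \<in> {i} \<times> (UNIV :: 'n set)" and A: "A \<in> sets borel"
    then obtain j where k: "k = (i, j)" by auto
    have "(\<lambda>x::real^'n. x $ j) -` A \<in> sets borel"
      by (rule measurable_sets_borel[OF borel_measurable_vec_nth A])
    then show "(case k of (i, j) \<Rightarrow> \<lambda>\<omega>. X i \<omega> $ j) -` A \<inter> space M \<in> {X i -` A \<inter> space M | A. A \<in> sets borel}"
      unfolding k by (auto intro!: exI[of _ "(\<lambda>x::real^'n. x $ j) -` A"])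
  qed
  also have "(\<Union>i\<in>I. {i} \<times> UNIV) = I \<times> (UNIV :: 'n set)"
    by auto
  finally show ?thesis .
qed

section \<open>Linear combinations of independent Gaussian vectors\<close>

lemma (in prob_space) distributed_normal_scale:
  assumes "c > 0" "a \<noteq> 0" "distributed M lborel Z (normal_density 0 (sqrt c))"
  shows "distributed M lborel (\<lambda>\<omega>. a * Z \<omega>) (normal_density 0 (sqrt (a\<^sup>2 * c)))"
  using normal_density_affine[OF assms(3), of a 0] assms(1,2) by (simp add: real_sqrt_mult)

lemma (in prob_space) iso_gaussian_scale:
  fixes X :: "'a \<Rightarrow> real^'n"
  assumes X: "iso_gaussian M c X" and "c > 0" "a \<noteq> 0"
  shows "iso_gaussian M (a\<^sup>2 * c) (\<lambda>\<omega>. a *\<^sub>R X \<omega>)"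
proof -
  have pos: "a\<^sup>2 * c > 0" using assms by simp
  have "indep_vars (\<lambda>_. borel) (\<lambda>i \<omega>. a * X \<omega> $ i) UNIV"
    using X \<open>c > 0\<close> by (intro indep_vars_compose2[where M'="\<lambda>_. borel" and Y="\<lambda>_ x. a * x"])
      (auto simp: iso_gaussian_iff_coordinates)
  moreover have "distributed M lborel (\<lambda>\<omega>. a * X \<omega> $ i) (normal_density 0 (sqrt (a\<^sup>2 * c)))" for i
    using X assms by (intro distributed_normal_scale) (auto simp: iso_gaussian_iff_coordinates)
  ultimately show ?thesis
    by (subst iso_gaussian_iff_coordinates[OF pos]) simp
qed

text \<open>The coordinates of the sum are independent because they are built from disjoint pairs of
  coordinates, and each of them is a sum of two independent normal variables.\<close>

lemma (in prob_space) iso_gaussian_add: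
  fixes X :: "'i \<Rightarrow> 'a \<Rightarrow> real^'n"
  assumes indep: "indep_vars (\<lambda>_. borel) X I"
    and gauss: "\<And>i. i \<in> I \<Longrightarrow> iso_gaussian M c (X i)" and "c > 0"
    and ab: "a \<in> I" "b \<in> I" "a \<noteq> b"
    and "r \<noteq> 0"
  shows "iso_gaussian M ((r\<^sup>2 + 1) * c) (\<lambda>\<omega>. r *\<^sub>R X a \<omega> + X b \<omega>)"
proof -
  have pos: "(r\<^sup>2 + 1) * c > 0"
    using \<open>c > 0\<close> by (intro mult_pos_pos add_nonneg_pos) auto
  let ?g = "\<lambda>(i, j) \<omega>. X i \<omega> $ j"
  have coords: "indep_vars (\<lambda>_. borel) ?g (I \<times> UNIV)"
    using indep gauss \<open>c > 0\<close> by (rule indep_vars_coordinates)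
  have d: "distributed M lborel (\<lambda>\<omega>. X i \<omega> $ j) (normal_density 0 (sqrt c))" if "i \<in> I" for i j
    using gauss[OF that] \<open>c > 0\<close> by (simp add: iso_gaussian_iff_coordinates)
  have "indep_vars (\<lambda>_. borel) (\<lambda>j \<omega>. r * ?g (a, j) \<omega> + ?g (b, j) \<omega>) UNIV"
    using ab by (intro indep_vars_pairs[OF coords]) (auto simp: disjoint_family_on_def)
  then have "indep_vars (\<lambda>_. borel) (\<lambda>j \<omega>. (r *\<^sub>R X a \<omega> + X b \<omega>) $ j) UNIV"
    by simp
  moreover have "distributed M lborel (\<lambda>\<omega>. (r *\<^sub>R X a \<omega> + X b \<omega>) $ j) (normal_density 0 (sqrt ((r\<^sup>2 + 1) * c)))" for j
  proof -
    have "indep_vars (\<lambda>_. borel) ?g {(a, j), (b, j)}"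
      using ab by (intro indep_vars_subset[OF coords]) auto
    then have "indep_vars (\<lambda>_. borel) (\<lambda>p \<omega>. (if fst p = a then r else 1) * ?g p \<omega>) {(a, j), (b, j)}"
      by (rule indep_vars_compose2) auto
    then have "distributed M lborel (\<lambda>\<omega>. \<Sum>p\<in>{(a, j), (b, j)}. (if fst p = a then r else 1) * ?g p \<omega>)
      (normal_density (\<Sum>p\<in>{(a, j), (b, j)}. 0)
        (sqrt (\<Sum>p\<in>{(a, j), (b, j)}. (sqrt ((if fst p = a then r else 1)\<^sup>2 * c))\<^sup>2)))"
      using ab \<open>r \<noteq> 0\<close> \<open>c > 0\<close> d distributed_normal_scale[OF \<open>c > 0\<close> \<open>r \<noteq> 0\<close> d]
      by (intro sum_indep_normal) auto
    then show ?thesis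
      using ab \<open>c > 0\<close> by (simp add: algebra_simps)
  qed
  ultimately show ?thesis
    by (subst iso_gaussian_iff_coordinates[OF pos]) simp
qed

text \<open>The common form of the noise of AOBOA, BOAOB and OABAO: the index \<open>l\<close> of the step selects two
  driving variables, and different steps select disjoint pairs.\<close>

lemma (in prob_space) pair_noise:
  fixes \<xi> :: "'i \<Rightarrow> 'a \<Rightarrow> real^'n"
  assumes indep: "indep_vars (\<lambda>_. borel) \<xi> I"
    and ab: "\<And>l. l \<in> L \<Longrightarrow> a l \<in> I \<and> b l \<in> I"
    and disj: "disjoint_family_on (\<lambda>l. {a l, b l}) L"
  shows indep_seq_pair_noise: "indep_seq M L (\<lambda>l \<omega>. c *\<^sub>R (r *\<^sub>R \<xi> (a l) \<omega> + \<xi> (b l) \<omega>))"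
    and iso_gaussian_pair_noise: "\<And>l. (\<And>i. i \<in> I \<Longrightarrow> iso_gaussian M 1 (\<xi> i)) \<Longrightarrow> l \<in> L \<Longrightarrow>
      a l \<noteq> b l \<Longrightarrow> r \<noteq> 0 \<Longrightarrow> c \<noteq> 0 \<Longrightarrow>
      iso_gaussian M (c\<^sup>2 * (r\<^sup>2 + 1)) (\<lambda>\<omega>. c *\<^sub>R (r *\<^sub>R \<xi> (a l) \<omega> + \<xi> (b l) \<omega>))"
proof -
  show "indep_seq M L (\<lambda>l \<omega>. c *\<^sub>R (r *\<^sub>R \<xi> (a l) \<omega> + \<xi> (b l) \<omega>))"
    unfolding indep_seq_def using indep ab disj by (rule indep_vars_pairs) measurable
  fix l assume g: "\<And>i. i \<in> I \<Longrightarrow> iso_gaussian M 1 (\<xi> i)" and l: "l \<in> L" "a l \<noteq> b l" and rc: "r \<noteq> 0" "c \<noteq> 0"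
  have "iso_gaussian M ((r\<^sup>2 + 1) * 1) (\<lambda>\<omega>. r *\<^sub>R \<xi> (a l) \<omega> + \<xi> (b l) \<omega>)"
    using indep g l ab rc by (intro iso_gaussian_add[where I=I]) auto
  moreover have "(r\<^sup>2 + 1) * 1 > 0" by (auto intro: add_nonneg_pos)
  ultimately have "iso_gaussian M (c\<^sup>2 * ((r\<^sup>2 + 1) * 1)) (\<lambda>\<omega>. c *\<^sub>R (r *\<^sub>R \<xi> (a l) \<omega> + \<xi> (b l) \<omega>))"
    using rc by (rule_tac iso_gaussian_scale)
  then show "iso_gaussian M (c\<^sup>2 * (r\<^sup>2 + 1)) (\<lambda>\<omega>. c *\<^sub>R (r *\<^sub>R \<xi> (a l) \<omega> + \<xi> (b l) \<omega>))"
    by simp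
qed

lemma real_gaussian_cong:
  assumes "\<And>\<omega>. \<omega> \<in> space M \<Longrightarrow> X \<omega> = Y \<omega>"
  shows "real_gaussian M X \<longleftrightarrow> real_gaussian M Y"
proof -
  have "distr M N X = distr M N Y" for N
    using assms by (intro distr_cong) auto
  moreover have "X \<in> measurable M N \<longleftrightarrow> Y \<in> measurable M N" for N
    using assms by (rule measurable_cong)
  ultimately show ?thesis
    by (simp add: real_gaussian_def distributed_def)
qed

text \<open>If all coefficients vanish the sum is a point mass, otherwise the terms with a nonzero coefficient
  add up to a nondegenerate normal variable.\<close>

lemma (in prob_space) real_gaussian_linear_combination:
  fixes g :: "'i \<Rightarrow> 'a \<Rightarrow> real"
  assumes "finite J" and indep: "indep_vars (\<lambda>_. borel) g J"
    and normal: "\<And>i. i \<in> J \<Longrightarrow> distributed M lborel (g i) (normal_density 0 (sqrt c))" and "c > 0"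
  shows "real_gaussian M (\<lambda>\<omega>. \<Sum>i\<in>J. b i * g i \<omega>)"
proof -
  define J' where "J' = {i \<in> J. b i \<noteq> 0}"
  have J': "finite J'" "J' \<subseteq> J" using \<open>finite J\<close> by (auto simp: J'_def)
  have sum_eq: "(\<Sum>i\<in>J. b i * g i \<omega>) = (\<Sum>i\<in>J'. b i * g i \<omega>)" for \<omega>
    using \<open>finite J\<close> by (intro sum.mono_neutral_right) (auto simp: J'_def)
  show ?thesis
  proof (cases "J' = {}")
    case True
    have "distr M borel (\<lambda>_. 0) = return borel (0::real)"
      by (rule measure_eqI) (auto simp: emeasure_distr emeasure_space_1 indicator_def)
    then show ?thesis
      unfolding sum_eq real_gaussian_def using True by (intro disjI2 exI[of _ 0]) auto
  next
    case False
    have "indep_vars (\<lambda>_. borel) (\<lambda>i \<omega>. b i * g i \<omega>) J'"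
      using indep_vars_subset[OF indep J'(2)] by (rule indep_vars_compose2) auto
    then have "distributed M lborel (\<lambda>\<omega>. \<Sum>i\<in>J'. b i * g i \<omega>)
        (normal_density (\<Sum>i\<in>J'. 0) (sqrt (\<Sum>i\<in>J'. (sqrt ((b i)\<^sup>2 * c))\<^sup>2)))"
      using J' False normal \<open>c > 0\<close>
      by (intro sum_indep_normal distributed_normal_scale) (auto simp: J'_def)
    moreover have "(\<Sum>i\<in>J'. (sqrt ((b i)\<^sup>2 * c))\<^sup>2) > 0"
      using J' False \<open>c > 0\<close> by (intro sum_pos) (auto simp: J'_def)
    ultimately show ?thesis
      unfolding sum_eq real_gaussian_def by (intro disjI1 exI conjI) auto
  qed
qed

section \<open>Covariances\<close>

text \<open>The entries may themselves be vectors, so that two applications of this rule reduce the integral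
  of a matrix to integrals of real functions.\<close>

lemma has_bochner_integral_vecI:
  fixes f :: "'w \<Rightarrow> 'b::euclidean_space^'n"
  assumes "\<And>i. has_bochner_integral M (\<lambda>\<omega>. f \<omega> $ i) (c $ i)"
  shows "has_bochner_integral M f c"
proof -
  have lin: "bounded_linear (axis i :: 'b \<Rightarrow> 'b^'n)" for i
    by (intro linear_conv_bounded_linear[THEN iffD1] linearI) (auto simp: axis_def vec_eq_iff)
  have eq: "(\<Sum>i\<in>UNIV. axis i (x $ i)) = x" for x :: "'b^'n"
    by (auto simp: vec_eq_iff axis_def if_distrib cong: if_cong)
  have "has_bochner_integral M (\<lambda>\<omega>. \<Sum>i\<in>UNIV. axis i (f \<omega> $ i)) (\<Sum>i\<in>UNIV. axis i (c $ i))"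
    by (intro has_bochner_integral_sum has_bochner_integral_bounded_linear[OF lin] assms)
  then show ?thesis by (simp add: eq)
qed

lemma outer_nth: "outer x y $ i $ j = x $ i * y $ j"
  by (simp add: outer_def matrix_matrix_mult_def columnvector_def rowvector_def)

lemma has_cross_momentI:
  assumes "\<And>i j. has_bochner_integral M (\<lambda>\<omega>. X \<omega> $ i * Y \<omega> $ j) (C $ i $ j)"
  shows "has_cross_moment M X Y C"
  unfolding has_cross_moment_def by (intro has_bochner_integral_vecI) (simp add: outer_nth assms)

lemma (in prob_space) normal_moments:
  assumes "c > 0" and D: "distributed M lborel Z (normal_density 0 (sqrt c))"
  shows "has_bochner_integral M Z 0" "has_bochner_integral M (\<lambda>\<omega>. Z \<omega> * Z \<omega>) c"
proof -
  have s: "sqrt c > 0" using assms by simp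
  have "integrable M Z"
    using integrable_normal_moment[OF s, of 0 1]
    by (intro distributed_integrable_var[OF D]) auto
  then show 1: "has_bochner_integral M Z 0"
    using normal_distributed_expectation[OF s D] by (simp add: has_bochner_integral_iff)
  have "integrable M (\<lambda>\<omega>. (Z \<omega>)\<^sup>2)"
    using integrable_normal_moment[OF s, of 0 2]
    by (subst distributed_integrable[OF D, symmetric, where g="\<lambda>x. x\<^sup>2"]) auto
  then show "has_bochner_integral M (\<lambda>\<omega>. Z \<omega> * Z \<omega>) c"
    using normal_distributed_variance[OF s D] normal_distributed_expectation[OF s D] \<open>c > 0\<close>
    by (simp add: has_bochner_integral_iff power2_eq_square)
qed

text \<open>Distinct coordinates, of the same vector or of two different ones, are independent and centered, so
  that only the squares of single coordinates contribute.\<close>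

lemma (in prob_space) iso_gaussian_moments:
  fixes X :: "'i \<Rightarrow> 'a \<Rightarrow> real^'n"
  assumes indep: "indep_vars (\<lambda>_. borel) X I"
    and gauss: "\<And>i. i \<in> I \<Longrightarrow> iso_gaussian M c (X i)" and "c > 0"
    and kl: "k \<in> I" "l \<in> I"
  shows "has_bochner_integral M (X k) 0"
    and "has_cross_moment M (X k) (X l) (mat (if k = l then c else 0))"
proof -
  have d: "distributed M lborel (\<lambda>\<omega>. X i \<omega> $ j) (normal_density 0 (sqrt c))" if "i \<in> I" for i j
    using gauss[OF that] \<open>c > 0\<close> by (simp add: iso_gaussian_iff_coordinates)
  note mom = normal_moments[OF \<open>c > 0\<close> d]
  show "has_bochner_integral M (X k) 0"
    using mom kl by (intro has_bochner_integral_vecI) simp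
  let ?g = "\<lambda>(i, j) \<omega>. X i \<omega> $ j"
  have coords: "indep_vars (\<lambda>_. borel) ?g (I \<times> UNIV)"
    using indep gauss \<open>c > 0\<close> by (rule indep_vars_coordinates)
  show "has_cross_moment M (X k) (X l) (mat (if k = l then c else 0))"
  proof (rule has_cross_momentI)
    fix i j
    show "has_bochner_integral M (\<lambda>\<omega>. X k \<omega> $ i * X l \<omega> $ j) (mat (if k = l then c else 0) $ i $ j)"
    proof (cases "(k, i) = (l, j)")
      case True
      then show ?thesis using mom(2) kl by (simp add: mat_def)
    next
      case False
      have ind: "indep_vars (\<lambda>_. borel) ?g {(k, i), (l, j)}"
        using kl by (intro indep_vars_subset[OF coords]) auto
      have int: "integrable M (?g p)" "expectation (?g p) = 0" if "p \<in> {(k, i), (l, j)}" for p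
        using that mom(1)[of k i] mom(1)[of l j] kl by (auto simp: has_bochner_integral_iff)
      have "integrable M (\<lambda>\<omega>. \<Prod>p\<in>{(k, i), (l, j)}. ?g p \<omega>)"
        by (intro indep_vars_integrable ind int) auto
      moreover have "expectation (\<lambda>\<omega>. \<Prod>p\<in>{(k, i), (l, j)}. ?g p \<omega>) = (\<Prod>p\<in>{(k, i), (l, j)}. expectation (?g p))"
        by (intro indep_vars_lebesgue_integral ind int) auto
      ultimately have "has_bochner_integral M (\<lambda>\<omega>. X k \<omega> $ i * X l \<omega> $ j) 0"
        using False int(2)[of "(k, i)"] by (simp add: has_bochner_integral_iff)
      then show ?thesis using False by (auto simp: mat_def)
    qed
  qed
qed

lemma (in prob_space) iso_gaussian_has_covariance:
  fixes X :: "'a \<Rightarrow> real^'n"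
  assumes "iso_gaussian M c X" "c > 0"
  shows "has_covariance M X (mat c)"
proof -
  have "indep_vars (\<lambda>_. borel) (\<lambda>_. X) {()}"
    using assms(1) by (auto simp: indep_vars_def2 indep_sets_def iso_gaussian_iff_distr subset_singleton_iff)
  from iso_gaussian_moments[OF this, of c "()" "()"] assms show ?thesis
    unfolding has_covariance_def by (intro exI[of _ 0]) auto
qed

lemma has_covariance_cong:
  assumes "\<And>\<omega>. \<omega> \<in> space M \<Longrightarrow> X \<omega> = Y \<omega>"
  shows "has_covariance M X C \<longleftrightarrow> has_covariance M Y C"
  unfolding has_covariance_def has_cross_moment_def
  using assms by (intro ex_cong1 conj_cong has_bochner_integral_cong) auto

lemma outer_scaleR_add:
  "outer (a *\<^sub>R (x + y)) (a *\<^sub>R (z + w)) = a\<^sup>2 *\<^sub>R ((outer x z + outer x w) + (outer y z + outer y w))"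
  by (simp add: vec_eq_iff outer_nth power2_eq_square algebra_simps)

lemma mat_add: "mat a + mat b = (mat (a + b) :: real^'n^'n)"
  by (simp add: vec_eq_iff mat_def)

lemma scaleR_mat: "a *\<^sub>R mat b = (mat (a * b) :: real^'n^'n)"
  by (simp add: vec_eq_iff mat_def)

section \<open>Moving averages of white Gaussian noise\<close>

text \<open>The white noise \<open>G\<close> is indexed from \<open>n\<close> on, hence the moving average from \<open>Suc n\<close> on. The
  identity for \<open>\<zeta>\<close> is required on the probability space only, since random variables
  carry no information outside of it.\<close>

locale moving_average = prob_space M for M :: "'w measure" +
  fixes n :: nat and G \<zeta> :: "nat \<Rightarrow> 'w \<Rightarrow> real^'n" and a c :: real
  assumes indep: "indep_seq M {n..} G"
    and gauss: "\<And>m. m \<ge> n \<Longrightarrow> iso_gaussian M c (G m)"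
    and c_pos: "c > 0"
    and \<zeta>_eq: "\<And>k \<omega>. k \<ge> Suc n \<Longrightarrow> \<omega> \<in> space M \<Longrightarrow> \<zeta> k \<omega> = a *\<^sub>R (G (k - 1) \<omega> + G k \<omega>)"
begin

lemma indep_G: "indep_vars (\<lambda>_. borel) G {n..}"
  using indep by (simp add: indep_seq_def)

lemma measurable_G: "m \<ge> n \<Longrightarrow> G m \<in> borel_measurable M"
  using indep_G by (simp add: indep_vars_def2)

lemma measurable_\<zeta>: "k \<ge> Suc n \<Longrightarrow> \<zeta> k \<in> borel_measurable M"
  using measurable_G by (subst measurable_cong[OF \<zeta>_eq]) auto

lemmas G_moments = iso_gaussian_moments[OF indep_G gauss c_pos, simplified]

lemma mean_zero:
  assumes "k \<ge> Suc n"
  shows "has_bochner_integral M (\<zeta> k) 0"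
proof -
  have "has_bochner_integral M (\<lambda>\<omega>. a *\<^sub>R (G (k - 1) \<omega> + G k \<omega>)) (a *\<^sub>R (0 + 0))"
    using assms by (intro has_bochner_integral_scaleR_right has_bochner_integral_add G_moments(1)[of _ n]) auto
  then show ?thesis
    by (subst has_bochner_integral_cong[OF refl \<zeta>_eq refl]) (use assms in auto)
qed

text \<open>Expanding the outer product leaves four moments of the white noise, which vanish unless the two
  indices agree.\<close>

lemma cross_moment:
  assumes kl: "k \<ge> Suc n" "l \<ge> Suc n"
  defines "\<delta> \<equiv> \<lambda>i j. if i = j then c else 0"
  shows "has_cross_moment M (\<zeta> k) (\<zeta> l)
    (mat (a\<^sup>2 * (\<delta> (k - 1) (l - 1) + \<delta> (k - 1) l + (\<delta> k (l - 1) + \<delta> k l))))"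
proof -
  have G: "has_bochner_integral M (\<lambda>\<omega>. outer (G i \<omega>) (G j \<omega>)) (mat (\<delta> i j))" if "i \<ge> n" "j \<ge> n" for i j
    using G_moments(2)[of i j] that by (simp add: \<delta>_def has_cross_moment_def)
  have "has_bochner_integral M (\<lambda>\<omega>. outer (a *\<^sub>R (G (k - 1) \<omega> + G k \<omega>)) (a *\<^sub>R (G (l - 1) \<omega> + G l \<omega>)))
    (a\<^sup>2 *\<^sub>R ((mat (\<delta> (k - 1) (l - 1)) + mat (\<delta> (k - 1) l)) + (mat (\<delta> k (l - 1)) + mat (\<delta> k l))))"
    unfolding outer_scaleR_add using kl
    by (intro has_bochner_integral_scaleR_right has_bochner_integral_add G) auto
  then show ?thesis
    unfolding has_cross_moment_def mat_add scaleR_mat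
    by (rule has_bochner_integral_cong[THEN iffD1, rotated -1]) (use \<zeta>_eq kl in auto)
qed

text \<open>Regrouping the terms: a linear combination of the moving averages is one of the white noise, whose
  coefficient at \<open>m\<close> collects the contributions of \<open>\<zeta> (Suc m)\<close> and \<open>\<zeta> m\<close>.\<close>

lemma gaussian: "gaussian_sequence M {Suc n..} \<zeta>"
  unfolding gaussian_sequence_def
proof (intro allI impI, elim conjE)
  fix F :: "nat set" and u :: "nat \<Rightarrow> real^'n"
  assume F: "finite F" "F \<subseteq> {Suc n..}"
  define J where "J = F \<union> (\<lambda>k. k - 1) ` F"
  \<comment> \<open>Outside \<open>F\<close> the values of \<open>u\<close> are arbitrary and must not contribute.\<close>
  define b where "b m = a *\<^sub>R ((if Suc m \<in> F then u (Suc m) else 0) + (if m \<in> F then u m else 0))" for m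
  have J: "finite J" "J \<subseteq> {n..}" using F by (auto simp: J_def)
  have inj: "inj_on (\<lambda>k. k - 1) F"
    using F by (intro inj_onI) (metis Suc_diff_1 atLeast_iff less_le_trans subsetD zero_less_Suc)
  have pred: "\<And>k. k \<in> F \<Longrightarrow> Suc (k - 1) = k" using F by fastforce
  have "(\<Sum>k\<in>F. u k \<bullet> \<zeta> k \<omega>) = (\<Sum>p\<in>J \<times> UNIV. b (fst p) $ snd p * (case p of (i, j) \<Rightarrow> \<lambda>\<omega>. G i \<omega> $ j) \<omega>)"
    if \<omega>: "\<omega> \<in> space M" for \<omega>
  proof -
    have "(\<Sum>k\<in>F. u k \<bullet> \<zeta> k \<omega>) = (\<Sum>k\<in>F. (a *\<^sub>R u k) \<bullet> G (k - 1) \<omega>) + (\<Sum>k\<in>F. (a *\<^sub>R u k) \<bullet> G k \<omega>)"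
      using F \<omega> by (subst sum.distrib[symmetric]) (auto simp: \<zeta>_eq subset_iff inner_add_right algebra_simps intro!: sum.cong)
    also have "(\<Sum>k\<in>F. (a *\<^sub>R u k) \<bullet> G (k - 1) \<omega>) = (\<Sum>m\<in>(\<lambda>k. k - 1) ` F. (a *\<^sub>R u (Suc m)) \<bullet> G m \<omega>)"
      using inj pred by (simp add: sum.reindex)
    also have "\<dots> = (\<Sum>m\<in>J. (a *\<^sub>R (if Suc m \<in> F then u (Suc m) else 0)) \<bullet> G m \<omega>)"
      using J(1) pred
      by (intro sum.mono_neutral_cong_left) (auto simp: J_def image_iff, (metis diff_Suc_1)+)
    also have "(\<Sum>k\<in>F. (a *\<^sub>R u k) \<bullet> G k \<omega>) = (\<Sum>m\<in>J. (a *\<^sub>R (if m \<in> F then u m else 0)) \<bullet> G m \<omega>)"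
      using J(1) by (intro sum.mono_neutral_cong_left) (auto simp: J_def)
    finally have "(\<Sum>k\<in>F. u k \<bullet> \<zeta> k \<omega>) = (\<Sum>m\<in>J. b m \<bullet> G m \<omega>)"
      by (simp add: sum.distrib[symmetric] b_def inner_add_left scaleR_add_right)
    then show ?thesis
      by (simp add: inner_vec_def sum.cartesian_product split_beta)
  qed
  then have eq: "real_gaussian M (\<lambda>\<omega>. \<Sum>k\<in>F. u k \<bullet> \<zeta> k \<omega>) \<longleftrightarrow>
    real_gaussian M (\<lambda>\<omega>. \<Sum>p\<in>J \<times> UNIV. b (fst p) $ snd p * (case p of (i, j) \<Rightarrow> \<lambda>\<omega>. G i \<omega> $ j) \<omega>)"
    by (rule real_gaussian_cong)
  show "real_gaussian M (\<lambda>\<omega>. \<Sum>k\<in>F. u k \<bullet> \<zeta> k \<omega>)"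
    unfolding eq
  proof (rule real_gaussian_linear_combination)
    show "indep_vars (\<lambda>_. borel) (\<lambda>(i, j) \<omega>. G i \<omega> $ j) (J \<times> UNIV)"
      using indep_vars_subset[OF indep_G J(2)] gauss c_pos J(2)
      by (intro indep_vars_coordinates[where c=c]) auto
    show "distributed M lborel (case p of (i, j) \<Rightarrow> \<lambda>\<omega>. G i \<omega> $ j) (normal_density 0 (sqrt c))"
      if "p \<in> J \<times> UNIV" for p
      using that gauss c_pos J(2) by (auto simp: iso_gaussian_iff_coordinates)
  qed (use J c_pos in auto)
qed

text \<open>Up to time \<open>k\<close> only the variables \<open>G m\<close> with \<open>m \<le> k\<close> are used, and from time \<open>k + 2\<close> on only those
  with \<open>m \<ge> k + 1\<close>.\<close>

lemma one_dependent_\<zeta>: "one_dependent M {Suc n..} \<zeta>"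
  unfolding one_dependent_def
proof
  fix k
  let ?L = "{i \<in> {Suc n..}. i \<le> k}" and ?R = "{i \<in> {Suc n..}. i \<ge> k + 2}"
  show "indep_rv M (prod_borel ?L) (joint ?L \<zeta>) (prod_borel ?R) (joint ?R \<zeta>)"
  proof (cases "k \<le> n")
    case True
    then have "\<And>\<omega>. joint ?L \<zeta> \<omega> = (\<lambda>_. undefined)" by (auto simp: fun_eq_iff)
    then show ?thesis
      using measurable_\<zeta> by (intro indep_rv_const[where x="\<lambda>_. undefined"] measurable_restrict)
         (use True in \<open>auto simp: space_PiM\<close>)
  next
    case False
    define \<Phi> where "\<Phi> K f = (\<lambda>k\<in>K. a *\<^sub>R (f (k - 1) + f k))" for K :: "nat set" and f :: "nat \<Rightarrow> real^'n"
    have \<Phi>: "\<Phi> K \<in> prod_borel A \<rightarrow>\<^sub>M prod_borel K" if "K \<union> (\<lambda>k. k - 1) ` K \<subseteq> A" for K A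
      unfolding \<Phi>_def using that
      by (intro measurable_restrict borel_measurable_scaleR borel_measurable_const borel_measurable_add measurable_component_singleton) auto
    have "indep_var (prod_borel {n..k}) (joint {n..k} G) (prod_borel {Suc k..}) (joint {Suc k..} G)"
      using False by (intro indep_var_restrict[OF indep_G]) auto
    then have "indep_var (prod_borel ?L) (\<Phi> ?L \<circ> joint {n..k} G) (prod_borel ?R) (\<Phi> ?R \<circ> joint {Suc k..} G)"
      by (rule indep_var_compose) (auto intro!: \<Phi>)
    then show ?thesis
      by (rule indep_rv_of_indep_var) (auto simp: \<Phi>_def \<zeta>_eq restrict_def fun_eq_iff)
  qed
qed

text \<open>The right-hand side does not mention \<open>M\<close> and \<open>G\<close>: the law is the image of a product of normal
  laws under one fixed map. This is what allows the comparison of two moving averages that live on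
  different probability spaces.\<close>

lemma law:
  "distr M (prod_borel {Suc n..}) (joint {Suc n..} \<zeta>) =
    distr (PiM {n..} (\<lambda>_. density lborel (iso_normal_density c))) (prod_borel {Suc n..})
      (\<lambda>f. \<lambda>k\<in>{Suc n..}. a *\<^sub>R (f (k - 1) + f k))"
proof -
  have "distr M (prod_borel {n..}) (joint {n..} G) = PiM {n..} (\<lambda>i. distr M borel (G i))"
    using indep_G measurable_G by (subst (asm) indep_vars_iff_distr_eq_PiM') auto
  also have "\<dots> = PiM {n..} (\<lambda>_. density lborel (iso_normal_density c))"
    using gauss by (intro PiM_cong) (auto simp: iso_gaussian_iff_distr)
  finally have G: "PiM {n..} (\<lambda>_. density lborel (iso_normal_density c)) = distr M (prod_borel {n..}) (joint {n..} G)"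
    by simp
  have "joint {n..} G \<in> M \<rightarrow>\<^sub>M prod_borel {n..}"
    using measurable_G by (intro measurable_restrict) auto
  moreover have "(\<lambda>f. \<lambda>k\<in>{Suc n..}. a *\<^sub>R (f (k - 1) + f k)) \<in> prod_borel {n..} \<rightarrow>\<^sub>M prod_borel {Suc n..}"
    by (intro measurable_restrict borel_measurable_scaleR borel_measurable_const borel_measurable_add measurable_component_singleton) auto
  ultimately show ?thesis
    unfolding G by (subst distr_distr) (auto intro!: distr_cong simp: \<zeta>_eq fun_eq_iff restrict_def)
qed

end

section \<open>The recursions, path by path\<close>

text \<open>The coefficients of the exact solution of the friction and noise part over a full step
  (\<open>\<beta>\<close> and \<open>varsigma\<close>) and over half a step (\<open>r\<close> and \<open>\<sigma>\<close>).\<close>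

locale ou_coefficients =
  fixes h \<gamma> \<beta> r \<sigma> varsigma :: real
  assumes h_pos: "h > 0" and \<gamma>_pos: "\<gamma> > 0"
    and \<beta>_def: "\<beta> = exp (- \<gamma> * h)" and r_def: "r = exp (- \<gamma> * h / 2)"
    and \<sigma>_def: "\<sigma> = sqrt (1 - \<beta>)" and varsigma_def: "varsigma = sqrt (1 - \<beta>\<^sup>2)"
begin

lemma r_pos: "r > 0" by (simp add: r_def)

lemma r_square: "r\<^sup>2 = \<beta>"
  by (simp add: r_def \<beta>_def exp_double[symmetric])

lemma sqrt_\<beta>: "sqrt \<beta> = r"
  using r_square r_pos by (metis less_imp_le real_sqrt_unique)

lemma \<beta>_less_1: "0 < \<beta>" "\<beta> < 1"
  using h_pos \<gamma>_pos by (simp_all add: \<beta>_def)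

lemma \<beta>_square_less_1: "\<beta>\<^sup>2 < 1"
  using \<beta>_less_1 by (simp add: power_less_one_iff)

lemma \<sigma>_pos: "\<sigma> > 0" and \<sigma>_square: "\<sigma>\<^sup>2 = 1 - \<beta>"
  using \<beta>_less_1 by (simp_all add: \<sigma>_def)

lemma varsigma_pos: "varsigma > 0" and varsigma_square: "varsigma\<^sup>2 = 1 - \<beta>\<^sup>2"
  using \<beta>_square_less_1 by (simp_all add: varsigma_def)

lemma pair_noise_variance: "\<sigma>\<^sup>2 * (r\<^sup>2 + 1) = 1 - \<beta>\<^sup>2"
  unfolding \<sigma>_square r_square by (simp add: power2_eq_square algebra_simps)

lemma O_map_half: "O_map \<gamma> (h/2) \<xi> (x, v) = (x, r *\<^sub>R v + \<sigma> *\<^sub>R \<xi>)"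
  by (simp add: O_map_def r_def \<sigma>_def \<beta>_def)

lemma O_map_full: "O_map \<gamma> h \<xi> (x, v) = (x, \<beta> *\<^sub>R v + varsigma *\<^sub>R \<xi>)"
  by (simp add: O_map_def \<beta>_def varsigma_def exp_double[symmetric] mult.assoc)

lemmas half_maps = A_map_def B_map_def O_map_half O_map_full

text \<open>Both half drifts around time \<open>m\<close> use the velocity \<open>v m\<close>, so the points in the middle of the
  steps differ by \<open>h v\<^sub>m\<close>. The choice of \<open>y 0\<close> makes this true for \<open>m = 0\<close> as well. The update of
  the velocity is then the recursion divided by \<open>h\<close>.\<close>

lemma ABOBA_recursion:
  fixes x v y \<xi> :: "nat \<Rightarrow> real^'n"
  assumes step: "\<And>k. (x (Suc k), v (Suc k)) = ABOBA_step gradU \<gamma> h (\<xi> (Suc k)) (x k, v k)"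
    and y: "\<And>m. y (Suc m) = x m + (h/2) *\<^sub>R v m" "y 0 = x 0 - (h/2) *\<^sub>R v 0"
  shows "y (Suc m) - y m = h *\<^sub>R v m"
    and "m \<ge> 1 \<Longrightarrow> y (Suc m) = y m + \<beta> *\<^sub>R (y m - y (m - 1))
      - (h\<^sup>2 / 2 * (1 + \<beta>)) *\<^sub>R gradU (y m) + (h * varsigma) *\<^sub>R \<xi> m"
proof -
  have v: "v (Suc k) = \<beta> *\<^sub>R (v k - (h/2) *\<^sub>R gradU (y (Suc k))) + varsigma *\<^sub>R \<xi> (Suc k)
        - (h/2) *\<^sub>R gradU (y (Suc k))"
    and x: "x (Suc k) = y (Suc k) + (h/2) *\<^sub>R v (Suc k)" for k
    using step[of k] by (auto simp: ABOBA_step_def half_maps y)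
  show diff: "y (Suc m) - y m = h *\<^sub>R v m" for m
  proof (cases m)
    case (Suc k)
    then show ?thesis using x[of k] y(1)[of "Suc k"] by (simp add: vec_eq_iff)
  qed (simp add: y vec_eq_iff)
  show "y (Suc m) = y m + \<beta> *\<^sub>R (y m - y (m - 1))
      - (h\<^sup>2 / 2 * (1 + \<beta>)) *\<^sub>R gradU (y m) + (h * varsigma) *\<^sub>R \<xi> m" if "m \<ge> 1"
  proof -
    obtain k where m: "m = Suc k" using \<open>m \<ge> 1\<close> by (cases m) auto
    have "y (Suc m) = y m + h *\<^sub>R v m" using diff[of m] by (simp add: algebra_simps)
    moreover have "y m - y (m - 1) = h *\<^sub>R v k" using diff[of k] by (simp add: m)
    ultimately show ?thesis
      unfolding m v by (simp add: vec_eq_iff algebra_simps power2_eq_square add_divide_distrib)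
  qed
qed

text \<open>The drifts are those of ABOBA. The gradient now enters before the second half of the friction,
  and is multiplied by \<open>r = sqrt \<beta>\<close>.\<close>

lemma AOBOA_recursion:
  fixes x v y :: "nat \<Rightarrow> real^'n" and \<xi> :: "nat \<Rightarrow> nat \<Rightarrow> real^'n"
  assumes step: "\<And>k. (x (Suc k), v (Suc k)) = AOBOA_step gradU \<gamma> h (\<xi> (Suc k) 1) (\<xi> (Suc k) 2) (x k, v k)"
    and y: "\<And>m. y (Suc m) = x m + (h/2) *\<^sub>R v m" "y 0 = x 0 - (h/2) *\<^sub>R v 0"
  shows "y (Suc m) - y m = h *\<^sub>R v m"
    and "m \<ge> 1 \<Longrightarrow> y (Suc m) = y m + \<beta> *\<^sub>R (y m - y (m - 1))
      - (sqrt \<beta> * h\<^sup>2) *\<^sub>R gradU (y m) + (h * \<sigma>) *\<^sub>R (r *\<^sub>R \<xi> m 1 + \<xi> m 2)"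
proof -
  have v: "v (Suc k) = r *\<^sub>R (r *\<^sub>R v k + \<sigma> *\<^sub>R \<xi> (Suc k) 1 - h *\<^sub>R gradU (y (Suc k))) + \<sigma> *\<^sub>R \<xi> (Suc k) 2"
    and x: "x (Suc k) = y (Suc k) + (h/2) *\<^sub>R v (Suc k)" for k
    using step[of k] by (auto simp: AOBOA_step_def half_maps y)
  show diff: "y (Suc m) - y m = h *\<^sub>R v m" for m
  proof (cases m)
    case (Suc k)
    then show ?thesis using x[of k] y(1)[of "Suc k"] by (simp add: vec_eq_iff)
  qed (simp add: y vec_eq_iff)
  show "y (Suc m) = y m + \<beta> *\<^sub>R (y m - y (m - 1))
      - (sqrt \<beta> * h\<^sup>2) *\<^sub>R gradU (y m) + (h * \<sigma>) *\<^sub>R (r *\<^sub>R \<xi> m 1 + \<xi> m 2)" if "m \<ge> 1"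
  proof -
    obtain k where m: "m = Suc k" using \<open>m \<ge> 1\<close> by (cases m) auto
    have "y (Suc m) = y m + h *\<^sub>R v m" using diff[of m] by (simp add: algebra_simps)
    moreover have "y m - y (m - 1) = h *\<^sub>R v k" using diff[of k] by (simp add: m)
    ultimately show ?thesis
      unfolding m v sqrt_\<beta> unfolding r_square[symmetric]
      by (simp add: vec_eq_iff algebra_simps power2_eq_square)
  qed
qed

text \<open>The drift velocity of step \<open>k\<close> is the increment of the position divided by \<open>h\<close>. The formula
  that this gives for \<open>v k\<close> with \<open>k \<ge> 1\<close> is the one that defines \<open>x\<^sub>m\<^sub>1\<close> for \<open>k = 0\<close>, so the recursion
  starts at zero.\<close>

lemma BOAOB_recursion:
  fixes x v :: "nat \<Rightarrow> real^'n" and \<xi> :: "nat \<Rightarrow> nat \<Rightarrow> real^'n"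
  assumes step: "\<And>k. (x (Suc k), v (Suc k)) = BOAOB_step gradU \<gamma> h (\<xi> (Suc k) 1) (\<xi> (Suc k) 2) (x k, v k)"
    and start: "v 0 = (r / h) *\<^sub>R (x 0 - x\<^sub>m\<^sub>1) + \<sigma> *\<^sub>R \<xi> 0 2 - (h/2) *\<^sub>R gradU (x 0)"
  shows "x (Suc k) = x k + \<beta> *\<^sub>R (x k - (if k = 0 then x\<^sub>m\<^sub>1 else x (k - 1)))
      - (sqrt \<beta> * h\<^sup>2) *\<^sub>R gradU (x k) + (h * \<sigma>) *\<^sub>R (r *\<^sub>R \<xi> k 2 + \<xi> (Suc k) 1)"
proof -
  define w where "w k = r *\<^sub>R (v k - (h/2) *\<^sub>R gradU (x k)) + \<sigma> *\<^sub>R \<xi> (Suc k) 1" for k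
  have x: "x (Suc k) = x k + h *\<^sub>R w k"
    and v: "v (Suc k) = r *\<^sub>R w k + \<sigma> *\<^sub>R \<xi> (Suc k) 2 - (h/2) *\<^sub>R gradU (x (Suc k))" for k
    using step[of k] by (auto simp: BOAOB_step_def half_maps w_def)
  define p where "p = (if k = 0 then x\<^sub>m\<^sub>1 else x (k - 1))"
  have vk: "v k = (r / h) *\<^sub>R (x k - p) + \<sigma> *\<^sub>R \<xi> k 2 - (h/2) *\<^sub>R gradU (x k)"
  proof (cases k)
    case (Suc j)
    have "w j = (1 / h) *\<^sub>R (x (Suc j) - x j)"
      using x[of j] h_pos by simp
    then show ?thesis
      unfolding Suc v p_def by simp
  qed (simp add: start p_def)
  have "x (Suc k) = x k + h *\<^sub>R (r *\<^sub>R ((r / h) *\<^sub>R (x k - p) + \<sigma> *\<^sub>R \<xi> k 2 - h *\<^sub>R gradU (x k))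
      + \<sigma> *\<^sub>R \<xi> (Suc k) 1)"
    unfolding x w_def vk by (simp add: vec_eq_iff field_simps)
  then show ?thesis
    unfolding p_def[symmetric] sqrt_\<beta> unfolding r_square[symmetric] using h_pos
    by (simp add: vec_eq_iff field_simps power2_eq_square)
qed

text \<open>Two drift velocities occur in a step, \<open>w\<close> before and \<open>u\<close> after the gradient is applied.
  The increment of \<open>y\<close> consists of half a drift with \<open>u\<close> and half a drift with the next \<open>w\<close>, and
  friction turns \<open>u\<close> into the next \<open>w\<close> up to the noise \<open>\<sigma> \<chi>\<close>. Multiplying the old increment by
  \<open>\<beta>\<close> therefore reproduces the new one up to the gradient and to the terms \<open>\<sigma> \<chi>\<^sub>m\<close> from the old and
  \<open>\<sigma> \<chi>\<^bsub>m+1\<^esub>\<close> from the new half drift.\<close>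

lemma OABAO_recursion:
  fixes x v y chi :: "nat \<Rightarrow> real^'n" and \<xi> :: "nat \<Rightarrow> nat \<Rightarrow> real^'n"
  assumes step: "\<And>k. (x (Suc k), v (Suc k)) = OABAO_step gradU \<gamma> h (\<xi> (Suc k) 1) (\<xi> (Suc k) 2) (x k, v k)"
    and chi: "\<And>m. m \<ge> 2 \<Longrightarrow> chi m = r *\<^sub>R \<xi> (m - 1) 2 + \<xi> m 1"
    and y: "\<And>m. m \<ge> 1 \<Longrightarrow> y m = x (m - 1) + (h/2) *\<^sub>R (r *\<^sub>R v (m - 1) + \<sigma> *\<^sub>R \<xi> m 1)"
    and "m \<ge> 2"
  shows "y (m + 1) = y m + \<beta> *\<^sub>R (y m - y (m - 1))
      - (h\<^sup>2 / 2 * (1 + \<beta>)) *\<^sub>R gradU (y m) + (h/2 * \<sigma>) *\<^sub>R (chi m + chi (m + 1))"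
proof -
  define w where "w k = r *\<^sub>R v k + \<sigma> *\<^sub>R \<xi> (Suc k) 1" for k
  define u where "u k = w k - h *\<^sub>R gradU (y (Suc k))" for k
  have yw: "y (Suc k) = x k + (h/2) *\<^sub>R w k" for k
    by (simp add: y w_def)
  have x: "x (Suc k) = y (Suc k) + (h/2) *\<^sub>R u k"
    and v: "v (Suc k) = r *\<^sub>R u k + \<sigma> *\<^sub>R \<xi> (Suc k) 2" for k
    using step[of k] by (auto simp: OABAO_step_def half_maps u_def yw w_def)
  have w: "w (Suc k) = \<beta> *\<^sub>R u k + \<sigma> *\<^sub>R chi (Suc (Suc k))" for k
    using chi[of "Suc (Suc k)"] by (simp add: w_def v r_square[symmetric] power2_eq_square algebra_simps)
  obtain k where m: "m = Suc (Suc k)"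
    using \<open>m \<ge> 2\<close> by (metis One_nat_def Suc_le_D Suc_1 Suc_le_mono)
  have u': "u (Suc k) = w (Suc k) - h *\<^sub>R gradU (y m)"
    by (simp add: u_def m)
  have "y (m + 1) = y m + (h/2) *\<^sub>R (u (Suc k) + w m)"
    using yw[of m] x[of "Suc k"] by (simp add: m scaleR_add_right add.assoc)
  also have "w m = \<beta> *\<^sub>R u (Suc k) + \<sigma> *\<^sub>R chi (m + 1)"
    using w[of "Suc k"] by (simp add: m)
  finally have y_next: "y (m + 1) = y m + (h/2) *\<^sub>R (u (Suc k) + (\<beta> *\<^sub>R u (Suc k) + \<sigma> *\<^sub>R chi (m + 1)))" .
  have "\<beta> *\<^sub>R (y m - y (m - 1)) = (h/2) *\<^sub>R (\<beta> *\<^sub>R u k + \<beta> *\<^sub>R w (Suc k))"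
    using yw[of "Suc k"] x[of k] by (simp add: m scaleR_add_right mult.commute)
  also have "\<beta> *\<^sub>R u k = w (Suc k) - \<sigma> *\<^sub>R chi m"
    using w[of k] by (simp add: m)
  finally have momentum: "\<beta> *\<^sub>R (y m - y (m - 1)) = (h/2) *\<^sub>R ((w (Suc k) - \<sigma> *\<^sub>R chi m) + \<beta> *\<^sub>R w (Suc k))" .
  show ?thesis
    unfolding y_next momentum u'
    by (simp add: vec_eq_iff algebra_simps power2_eq_square add_divide_distrib)
qed

end

section \<open>The four splittings\<close>

theorem proposition6p5:
  fixes M :: "'w measure"
    and N :: "'v measure"
    and U :: "real^'n \<Rightarrow> real"
    and gradU :: "real^'n \<Rightarrow> real^'n"
    and h \<gamma> \<beta> r \<sigma> varsigma :: real
  assumes "prob_space M"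
    and "\<And>x. GDERIV U x :> gradU x"
    and "strongly_convex U"
    and "\<exists>L. L-lipschitz_on UNIV gradU"
    and "h > 0" and "\<gamma> > 0"
    and "\<beta> = exp (- \<gamma> * h)" and "r = exp (- \<gamma> * h / 2)"
    and "\<sigma> = sqrt (1 - \<beta>)" and "varsigma = sqrt (1 - \<beta>\<^sup>2)"
  shows
    "(\<forall>\<xi> X V Y.
      chain1 M (ABOBA_step gradU \<gamma> h) \<xi> X V \<and>
      (\<forall>m. \<forall>\<omega>\<in>space M. Y (Suc m) \<omega> = X m \<omega> + (h/2) *\<^sub>R V m \<omega>) \<and>
      (\<forall>\<omega>\<in>space M. Y 0 \<omega> = X 0 \<omega> - (h/2) *\<^sub>R V 0 \<omega>) \<longrightarrow>
        (\<forall>m. \<forall>\<omega>\<in>space M. Y (Suc m) \<omega> - Y m \<omega> = h *\<^sub>R V m \<omega>) \<and>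
        (\<forall>m\<ge>1. \<forall>\<omega>\<in>space M.
           Y (Suc m) \<omega> = Y m \<omega> + \<beta> *\<^sub>R (Y m \<omega> - Y (m - 1) \<omega>)
             - (h\<^sup>2 / 2 * (1 + \<beta>)) *\<^sub>R gradU (Y m \<omega>) + (h * varsigma) *\<^sub>R \<xi> m \<omega>) \<and>
        indep_seq M {1..} (\<lambda>m \<omega>. (h * varsigma) *\<^sub>R \<xi> m \<omega>) \<and>
        (\<forall>m\<ge>1. has_covariance M (\<lambda>\<omega>. (h * varsigma) *\<^sub>R \<xi> m \<omega>) (mat (h\<^sup>2 * (1 - \<beta>\<^sup>2))))) \<and>
     (\<forall>\<xi> X V Y.
      chain2 M (AOBOA_step gradU \<gamma> h) \<xi> X V \<and>
      (\<forall>m. \<forall>\<omega>\<in>space M. Y (Suc m) \<omega> = X m \<omega> + (h/2) *\<^sub>R V m \<omega>) \<and>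
      (\<forall>\<omega>\<in>space M. Y 0 \<omega> = X 0 \<omega> - (h/2) *\<^sub>R V 0 \<omega>) \<longrightarrow>
        (\<forall>m. \<forall>\<omega>\<in>space M. Y (Suc m) \<omega> - Y m \<omega> = h *\<^sub>R V m \<omega>) \<and>
        (\<forall>m\<ge>1. \<forall>\<omega>\<in>space M.
           Y (Suc m) \<omega> = Y m \<omega> + \<beta> *\<^sub>R (Y m \<omega> - Y (m - 1) \<omega>)
             - (sqrt \<beta> * h\<^sup>2) *\<^sub>R gradU (Y m \<omega>)
             + (h * \<sigma>) *\<^sub>R (r *\<^sub>R \<xi> m 1 \<omega> + \<xi> m 2 \<omega>)) \<and>
        indep_seq M {1..} (\<lambda>m \<omega>. (h * \<sigma>) *\<^sub>R (r *\<^sub>R \<xi> m 1 \<omega> + \<xi> m 2 \<omega>)) \<and>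
        (\<forall>m\<ge>1. has_covariance M (\<lambda>\<omega>. (h * \<sigma>) *\<^sub>R (r *\<^sub>R \<xi> m 1 \<omega> + \<xi> m 2 \<omega>))
           (mat (h\<^sup>2 * (1 - \<beta>\<^sup>2))))) \<and>
     (\<forall>\<xi> X V X\<^sub>m\<^sub>1.
      chain2 M (BOAOB_step gradU \<gamma> h) \<xi> X V \<and>
      (gaussian_start M \<xi> \<or> zero_start M \<xi>) \<and>
      (\<forall>\<omega>\<in>space M. V 0 \<omega> =
         (r / h) *\<^sub>R (X 0 \<omega> - X\<^sub>m\<^sub>1 \<omega>) + \<sigma> *\<^sub>R \<xi> 0 2 \<omega> - (h/2) *\<^sub>R gradU (X 0 \<omega>)) \<longrightarrow>
        (\<forall>k. \<forall>\<omega>\<in>space M.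
           X (Suc k) \<omega> = X k \<omega>
             + \<beta> *\<^sub>R (X k \<omega> - (if k = 0 then X\<^sub>m\<^sub>1 \<omega> else X (k - 1) \<omega>))
             - (sqrt \<beta> * h\<^sup>2) *\<^sub>R gradU (X k \<omega>)
             + (h * \<sigma>) *\<^sub>R (r *\<^sub>R \<xi> k 2 \<omega> + \<xi> (Suc k) 1 \<omega>)) \<and>
        indep_seq M UNIV (\<lambda>k \<omega>. (h * \<sigma>) *\<^sub>R (r *\<^sub>R \<xi> k 2 \<omega> + \<xi> (Suc k) 1 \<omega>)) \<and>
        (gaussian_start M \<xi> \<longrightarrow>
           (\<forall>k. has_covariance M (\<lambda>\<omega>. (h * \<sigma>) *\<^sub>R (r *\<^sub>R \<xi> k 2 \<omega> + \<xi> (Suc k) 1 \<omega>))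
              (mat (h\<^sup>2 * (1 - \<beta>\<^sup>2))))) \<and>
        (zero_start M \<xi> \<longrightarrow>
           has_covariance M (\<lambda>\<omega>. (h * \<sigma>) *\<^sub>R (r *\<^sub>R \<xi> 0 2 \<omega> + \<xi> 1 1 \<omega>))
             (mat (h\<^sup>2 * (1 - \<beta>))) \<and>
           (\<forall>k\<ge>1. has_covariance M (\<lambda>\<omega>. (h * \<sigma>) *\<^sub>R (r *\<^sub>R \<xi> k 2 \<omega> + \<xi> (Suc k) 1 \<omega>))
              (mat (h\<^sup>2 * (1 - \<beta>\<^sup>2)))))) \<and>
     (\<forall>\<xi> X V chi Y \<zeta>.
      chain2 M (OABAO_step gradU \<gamma> h) \<xi> X V \<and>
      (\<forall>m\<ge>2. \<forall>\<omega>\<in>space M. chi m \<omega> = r *\<^sub>R \<xi> (m - 1) 2 \<omega> + \<xi> m 1 \<omega>) \<and>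
      (\<forall>m\<ge>1. \<forall>\<omega>\<in>space M.
         Y m \<omega> = X (m - 1) \<omega> + (h/2) *\<^sub>R (r *\<^sub>R V (m - 1) \<omega> + \<sigma> *\<^sub>R \<xi> m 1 \<omega>)) \<and>
      (\<forall>m\<ge>2. \<forall>\<omega>\<in>space M. \<zeta> (m + 1) \<omega> = (h/2 * \<sigma>) *\<^sub>R (chi m \<omega> + chi (m + 1) \<omega>)) \<longrightarrow>
        (\<forall>m\<ge>2. \<forall>\<omega>\<in>space M.
           Y (m + 1) \<omega> = Y m \<omega> + \<beta> *\<^sub>R (Y m \<omega> - Y (m - 1) \<omega>)
             - (h\<^sup>2 / 2 * (1 + \<beta>)) *\<^sub>R gradU (Y m \<omega>)
             + (h/2 * \<sigma>) *\<^sub>R (chi m \<omega> + chi (m + 1) \<omega>)) \<and>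
        indep_seq M {2..} (\<lambda>m \<omega>. \<sigma> *\<^sub>R chi m \<omega>) \<and>
        (\<forall>m\<ge>2. iso_gaussian M (1 - \<beta>\<^sup>2) (\<lambda>\<omega>. \<sigma> *\<^sub>R chi m \<omega>)) \<and>
        gaussian_sequence M {3..} \<zeta> \<and>
        (\<forall>k\<ge>3. has_bochner_integral M (\<zeta> k) 0) \<and>
        one_dependent M {3..} \<zeta> \<and>
        (\<forall>k\<ge>3. has_cross_moment M (\<zeta> k) (\<zeta> k) (mat (h\<^sup>2 / 2 * (1 - \<beta>\<^sup>2)))) \<and>
        (\<forall>k\<ge>3. has_cross_moment M (\<zeta> k) (\<zeta> (k + 1)) (mat (h\<^sup>2 / 4 * (1 - \<beta>\<^sup>2)))) \<and>
        (\<forall>\<eta>. prob_space N \<and> iid_std_gaussian N {3..} \<eta> \<longrightarrow>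
           distr M (prod_borel {3..}) (joint {3..} \<zeta>) =
           distr N (prod_borel {3..})
             (joint {3..} (\<lambda>k \<omega>. (h/2 * varsigma) *\<^sub>R (\<eta> k \<omega> + \<eta> (k + 1) \<omega>)))))"
proof -
  interpret prob_space M by fact
  interpret ou_coefficients h \<gamma> \<beta> r \<sigma> varsigma
    by unfold_locales (use assms in auto)
  note pos = h_pos r_pos \<sigma>_pos varsigma_pos \<beta>_less_1 \<beta>_square_less_1
  have pair_variance: "(h * \<sigma>)\<^sup>2 * (r\<^sup>2 + 1) = h\<^sup>2 * (1 - \<beta>\<^sup>2)"
    using pair_noise_variance by (simp add: power_mult_distrib)
  have variance_pos: "h\<^sup>2 * (1 - \<beta>\<^sup>2) > 0" "h\<^sup>2 * (1 - \<beta>) > 0"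
    using pos by simp_all
  have pair_covariance: "has_covariance M (\<lambda>\<omega>. (h * \<sigma>) *\<^sub>R (r *\<^sub>R \<xi> i \<omega> + \<xi> j \<omega>)) (mat (h\<^sup>2 * (1 - \<beta>\<^sup>2)))"
    if "indep_vars (\<lambda>_. borel) \<xi> I" "\<And>i. i \<in> I \<Longrightarrow> iso_gaussian M 1 (\<xi> i)" "i \<in> I" "j \<in> I" "i \<noteq> j"
    for \<xi> :: "nat \<times> nat \<Rightarrow> 'w \<Rightarrow> real^'n" and I i j
    using iso_gaussian_pair_noise[of \<xi> I "{()}" "\<lambda>_. i" "\<lambda>_. j" "()" r "h * \<sigma>"] that pos
      iso_gaussian_has_covariance[OF _ variance_pos(1)]
    by (simp add: pair_variance disjoint_family_on_def)
  show ?thesis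
  proof ((intro conjI; intro allI impI; elim conjE), goal_cases)
    case (1 \<xi> X V Y)
    note Y = 1(2,3)
    have indep: "indep_vars (\<lambda>_. borel) \<xi> {1..}"
      and gauss: "\<And>i. i \<ge> 1 \<Longrightarrow> iso_gaussian M 1 (\<xi> i)"
      and step: "\<And>k \<omega>. \<omega> \<in> space M \<Longrightarrow>
        (X (Suc k) \<omega>, V (Suc k) \<omega>) = ABOBA_step gradU \<gamma> h (\<xi> (Suc k) \<omega>) (X k \<omega>, V k \<omega>)"
      using 1(1) by (auto simp: chain1_def iid_std_gaussian_def indep_seq_def)
    note rec = ABOBA_recursion[where x="\<lambda>k. X k \<omega>" and v="\<lambda>k. V k \<omega>" and y="\<lambda>k. Y k \<omega>"
        and \<xi>="\<lambda>k. \<xi> k \<omega>" for \<omega>, OF step]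
    show ?case
    proof (intro conjI allI impI ballI)
      show "Y (Suc m) \<omega> - Y m \<omega> = h *\<^sub>R V m \<omega>" if "\<omega> \<in> space M" for m \<omega>
        using that Y by (intro rec(1)) auto
      show "Y (Suc m) \<omega> = Y m \<omega> + \<beta> *\<^sub>R (Y m \<omega> - Y (m - 1) \<omega>)
             - (h\<^sup>2 / 2 * (1 + \<beta>)) *\<^sub>R gradU (Y m \<omega>) + (h * varsigma) *\<^sub>R \<xi> m \<omega>"
        if "1 \<le> m" "\<omega> \<in> space M" for m \<omega>
        using that Y by (intro rec(2)) auto
      show "indep_seq M {1..} (\<lambda>m \<omega>. (h * varsigma) *\<^sub>R \<xi> m \<omega>)"
        unfolding indep_seq_def using indep by (rule indep_vars_compose2) auto
      show "has_covariance M (\<lambda>\<omega>. (h * varsigma) *\<^sub>R \<xi> m \<omega>) (mat (h\<^sup>2 * (1 - \<beta>\<^sup>2)))" if "1 \<le> m" for m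
        using iso_gaussian_scale[OF gauss[OF that], of "h * varsigma"] pos variance_pos
        by (intro iso_gaussian_has_covariance) (auto simp: power_mult_distrib varsigma_square)
    qed
  next
    case (2 \<xi> X V Y)
    note Y = 2(2,3)
    have indep: "indep_vars (\<lambda>_. borel) (case_prod \<xi>) noise_index"
      and gauss: "\<And>i. i \<in> noise_index \<Longrightarrow> iso_gaussian M 1 (case_prod \<xi> i)"
      and step: "\<And>k \<omega>. \<omega> \<in> space M \<Longrightarrow> (X (Suc k) \<omega>, V (Suc k) \<omega>) =
        AOBOA_step gradU \<gamma> h (\<xi> (Suc k) 1 \<omega>) (\<xi> (Suc k) 2 \<omega>) (X k \<omega>, V k \<omega>)"
      using 2(1) unfolding chain2_def iid_std_gaussian_def indep_seq_def by blast+
    note rec = AOBOA_recursion[where x="\<lambda>k. X k \<omega>" and v="\<lambda>k. V k \<omega>" and y="\<lambda>k. Y k \<omega>"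
        and \<xi>="\<lambda>k j. \<xi> k j \<omega>" for \<omega>, OF step]
    show ?case
    proof (intro conjI allI impI ballI)
      show "Y (Suc m) \<omega> - Y m \<omega> = h *\<^sub>R V m \<omega>" if "\<omega> \<in> space M" for m \<omega>
        using that Y by (intro rec(1)) auto
      show "Y (Suc m) \<omega> = Y m \<omega> + \<beta> *\<^sub>R (Y m \<omega> - Y (m - 1) \<omega>)
             - (sqrt \<beta> * h\<^sup>2) *\<^sub>R gradU (Y m \<omega>) + (h * \<sigma>) *\<^sub>R (r *\<^sub>R \<xi> m 1 \<omega> + \<xi> m 2 \<omega>)"
        if "1 \<le> m" "\<omega> \<in> space M" for m \<omega>
        using that Y by (intro rec(2)) auto
      show "indep_seq M {1..} (\<lambda>m \<omega>. (h * \<sigma>) *\<^sub>R (r *\<^sub>R \<xi> m 1 \<omega> + \<xi> m 2 \<omega>))"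
        using indep_seq_pair_noise[OF indep, of "{1..}" "\<lambda>m. (m, 1)" "\<lambda>m. (m, 2)" "h * \<sigma>" r]
        by (auto simp: noise_index_def disjoint_family_on_def)
      show "has_covariance M (\<lambda>\<omega>. (h * \<sigma>) *\<^sub>R (r *\<^sub>R \<xi> m 1 \<omega> + \<xi> m 2 \<omega>)) (mat (h\<^sup>2 * (1 - \<beta>\<^sup>2)))"
        if "1 \<le> m" for m
        using pair_covariance[OF indep gauss, of "(m, 1)" "(m, 2)"] that
        by (simp add: noise_index_def)
    qed
  next
    case (3 \<xi> X V X\<^sub>m\<^sub>1)
    note start = 3(2) and V0 = 3(3)
    have indep: "indep_vars (\<lambda>_. borel) (case_prod \<xi>) noise_index"
      and gauss: "\<And>i. i \<in> noise_index \<Longrightarrow> iso_gaussian M 1 (case_prod \<xi> i)"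
      and joint: "joint noise_index (case_prod \<xi>) \<in> measurable M (prod_borel noise_index)"
      and step: "\<And>k \<omega>. \<omega> \<in> space M \<Longrightarrow> (X (Suc k) \<omega>, V (Suc k) \<omega>) =
        BOAOB_step gradU \<gamma> h (\<xi> (Suc k) 1 \<omega>) (\<xi> (Suc k) 2 \<omega>) (X k \<omega>, V k \<omega>)"
      using 3(1) unfolding chain2_def iid_std_gaussian_def indep_seq_def indep_rv_def by blast+
    have "indep_rv M borel (case_prod \<xi> (0, 2)) (prod_borel noise_index) (joint noise_index (case_prod \<xi>))"
      using start
    proof
      assume "zero_start M \<xi>"
      then show ?thesis
        using joint by (intro indep_rv_const[where x=0]) (auto simp: zero_start_def)
    qed (simp add: gaussian_start_def)
    then have indep0: "indep_vars (\<lambda>_. borel) (case_prod \<xi>) (insert (0, 2) noise_index)"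
      using indep by (intro indep_vars_insert_indep_rv) (auto simp: noise_index_def)
    have pairs: "k \<in> UNIV \<Longrightarrow> (k, 2) \<in> insert (0, 2) noise_index \<and> (Suc k, 1) \<in> insert (0, 2) noise_index"
      "disjoint_family_on (\<lambda>k. {(k, 2), (Suc k, 1 :: nat)}) UNIV" for k :: nat
      by (auto simp: noise_index_def disjoint_family_on_def)
    note rec = BOAOB_recursion[where x="\<lambda>k. X k \<omega>" and v="\<lambda>k. V k \<omega>"
        and \<xi>="\<lambda>k j. \<xi> k j \<omega>" for \<omega>, OF step]
    show ?case
    proof (intro conjI allI impI ballI)
      show "X (Suc k) \<omega> = X k \<omega>
             + \<beta> *\<^sub>R (X k \<omega> - (if k = 0 then X\<^sub>m\<^sub>1 \<omega> else X (k - 1) \<omega>))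
             - (sqrt \<beta> * h\<^sup>2) *\<^sub>R gradU (X k \<omega>)
             + (h * \<sigma>) *\<^sub>R (r *\<^sub>R \<xi> k 2 \<omega> + \<xi> (Suc k) 1 \<omega>)" if "\<omega> \<in> space M" for k \<omega>
        using that V0 by (intro rec) auto
      show "indep_seq M UNIV (\<lambda>k \<omega>. (h * \<sigma>) *\<^sub>R (r *\<^sub>R \<xi> k 2 \<omega> + \<xi> (Suc k) 1 \<omega>))"
        using indep_seq_pair_noise[OF indep0 pairs, of "h * \<sigma>" r] by simp
      show "has_covariance M (\<lambda>\<omega>. (h * \<sigma>) *\<^sub>R (r *\<^sub>R \<xi> k 2 \<omega> + \<xi> (Suc k) 1 \<omega>)) (mat (h\<^sup>2 * (1 - \<beta>\<^sup>2)))"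
        if "gaussian_start M \<xi>" for k
      proof -
        have "iso_gaussian M 1 (case_prod \<xi> i)" if "i \<in> insert (0, 2) noise_index" for i
          using that gauss \<open>gaussian_start M \<xi>\<close> by (cases i) (auto simp: gaussian_start_def)
        from pair_covariance[OF indep0 this, of "(k, 2)" "(Suc k, 1)"] pairs(1)[of k] show ?thesis
          by simp
      qed
      show "has_covariance M (\<lambda>\<omega>. (h * \<sigma>) *\<^sub>R (r *\<^sub>R \<xi> k 2 \<omega> + \<xi> (Suc k) 1 \<omega>)) (mat (h\<^sup>2 * (1 - \<beta>\<^sup>2)))"
        if "1 \<le> k" for k
        using pair_covariance[OF indep gauss, of "(k, 2)" "(Suc k, 1)"] that
        by (simp add: noise_index_def)
      assume "zero_start M \<xi>"
      then have "(h * \<sigma>) *\<^sub>R (r *\<^sub>R \<xi> 0 2 \<omega> + \<xi> 1 1 \<omega>) = (h * \<sigma>) *\<^sub>R \<xi> 1 1 \<omega>" if "\<omega> \<in> space M" for \<omega>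
        using that by (simp add: zero_start_def)
      moreover have "has_covariance M (\<lambda>\<omega>. (h * \<sigma>) *\<^sub>R \<xi> 1 1 \<omega>) (mat (h\<^sup>2 * (1 - \<beta>)))"
        using iso_gaussian_scale[OF gauss[of "(1, 1)"], of "h * \<sigma>"] pos variance_pos
        by (intro iso_gaussian_has_covariance) (auto simp: noise_index_def power_mult_distrib \<sigma>_square)
      ultimately show "has_covariance M (\<lambda>\<omega>. (h * \<sigma>) *\<^sub>R (r *\<^sub>R \<xi> 0 2 \<omega> + \<xi> 1 1 \<omega>))
             (mat (h\<^sup>2 * (1 - \<beta>)))"
        by (rule has_covariance_cong[THEN iffD2])
    qed
  next
    case (4 \<xi> X V chi Y \<zeta>)
    note chi = 4(2) and Y = 4(3) and \<zeta> = 4(4)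
    have indep: "indep_vars (\<lambda>_. borel) (case_prod \<xi>) noise_index"
      and gauss: "\<And>i. i \<in> noise_index \<Longrightarrow> iso_gaussian M 1 (case_prod \<xi> i)"
      and step: "\<And>k \<omega>. \<omega> \<in> space M \<Longrightarrow> (X (Suc k) \<omega>, V (Suc k) \<omega>) =
        OABAO_step gradU \<gamma> h (\<xi> (Suc k) 1 \<omega>) (\<xi> (Suc k) 2 \<omega>) (X k \<omega>, V k \<omega>)"
      using 4(1) unfolding chain2_def iid_std_gaussian_def indep_seq_def by blast+
    note rec = OABAO_recursion[where x="\<lambda>k. X k \<omega>" and v="\<lambda>k. V k \<omega>" and y="\<lambda>k. Y k \<omega>"
        and chi="\<lambda>k. chi k \<omega>" and \<xi>="\<lambda>k j. \<xi> k j \<omega>" for \<omega>, OF step]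
    have pairs: "m \<in> {2..} \<Longrightarrow> (m - 1, 2) \<in> noise_index \<and> (m, 1) \<in> noise_index"
      "disjoint_family_on (\<lambda>m :: nat. {(m - 1, 2), (m, 1 :: nat)}) {2..}" for m :: nat
      by (auto simp: noise_index_def disjoint_family_on_def)
    have chi_indep: "indep_seq M {2..} (\<lambda>m \<omega>. \<sigma> *\<^sub>R chi m \<omega>)"
      using indep_seq_pair_noise[OF indep pairs, of \<sigma> r] chi unfolding indep_seq_def
      by (subst indep_vars_cong_on_space) auto
    have chi_gauss: "iso_gaussian M (1 - \<beta>\<^sup>2) (\<lambda>\<omega>. \<sigma> *\<^sub>R chi m \<omega>)" if "m \<ge> 2" for m
      using iso_gaussian_pair_noise[OF indep pairs gauss, of m r \<sigma>] chi that pos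
      by (subst iso_gaussian_cong) (auto simp: pair_noise_variance)
    interpret chi: moving_average M 2 "\<lambda>m \<omega>. \<sigma> *\<^sub>R chi m \<omega>" \<zeta> "h/2" "1 - \<beta>\<^sup>2"
    proof unfold_locales
      fix k \<omega> assume "k \<ge> Suc 2" "\<omega> \<in> space M"
      then show "\<zeta> k \<omega> = (h/2) *\<^sub>R (\<sigma> *\<^sub>R chi (k - 1) \<omega> + \<sigma> *\<^sub>R chi k \<omega>)"
        using \<zeta>[rule_format, of "k - 1" \<omega>] by (simp add: scaleR_add_right)
    qed (use chi_indep chi_gauss pos in auto)
    show ?case
    proof (intro conjI allI impI ballI; (elim conjE)?)
      show "Y (m + 1) \<omega> = Y m \<omega> + \<beta> *\<^sub>R (Y m \<omega> - Y (m - 1) \<omega>)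
             - (h\<^sup>2 / 2 * (1 + \<beta>)) *\<^sub>R gradU (Y m \<omega>)
             + (h/2 * \<sigma>) *\<^sub>R (chi m \<omega> + chi (m + 1) \<omega>)" if "2 \<le> m" "\<omega> \<in> space M" for m \<omega>
        using that Y chi by (intro rec) auto
      show "indep_seq M {2..} (\<lambda>m \<omega>. \<sigma> *\<^sub>R chi m \<omega>)" by fact
      show "iso_gaussian M (1 - \<beta>\<^sup>2) (\<lambda>\<omega>. \<sigma> *\<^sub>R chi m \<omega>)" if "2 \<le> m" for m
        using that by (rule chi_gauss)
      show "gaussian_sequence M {3..} \<zeta>" "one_dependent M {3..} \<zeta>"
        using chi.gaussian chi.one_dependent_\<zeta> by simp_all
      show "has_bochner_integral M (\<zeta> k) 0" if "3 \<le> k" for k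
        using that by (intro chi.mean_zero) simp
      show "has_cross_moment M (\<zeta> k) (\<zeta> k) (mat (h\<^sup>2 / 2 * (1 - \<beta>\<^sup>2)))" if "3 \<le> k" for k
      proof -
        have "k - 1 \<noteq> k" using that by auto
        then have "has_cross_moment M (\<zeta> k) (\<zeta> k) (mat ((h/2)\<^sup>2 * ((1 - \<beta>\<^sup>2) + (1 - \<beta>\<^sup>2))))"
          using chi.cross_moment[of k k] that by simp
        moreover have "(h/2)\<^sup>2 * ((1 - \<beta>\<^sup>2) + (1 - \<beta>\<^sup>2)) = h\<^sup>2 / 2 * (1 - \<beta>\<^sup>2)"
          by (simp add: power_divide field_simps)
        ultimately show ?thesis by (simp only:)
      qed
      show "has_cross_moment M (\<zeta> k) (\<zeta> (k + 1)) (mat (h\<^sup>2 / 4 * (1 - \<beta>\<^sup>2)))" if "3 \<le> k" for k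
      proof -
        have "k - 1 \<noteq> k" "k - 1 \<noteq> k + 1" using that by auto
        then show ?thesis
          using chi.cross_moment[of k "k + 1"] that by (simp add: power_divide)
      qed
      fix \<eta> :: "nat \<Rightarrow> 'v \<Rightarrow> real^'n"
      assume "prob_space N" and \<eta>: "iid_std_gaussian N {3..} \<eta>"
      interpret N: prob_space N by fact
      \<comment> \<open>The sequence \<open>\<eta>\<close> starts at 3 and each sum uses the current and the next term, whereas a moving
        average uses the previous and the current one; shifting by one reconciles both.\<close>
      have "Suc ` {2..} = {3..}"
        using image_add_atLeast[of 1 "2::nat"] by (simp add: plus_1_eq_Suc)
      then have "N.indep_vars (\<lambda>_. borel) \<eta> (Suc ` {2..})"
        using \<eta> by (simp add: iid_std_gaussian_def indep_seq_def)
      then have "N.indep_vars (\<lambda>_. borel) (\<lambda>m. \<eta> (Suc m)) {2..}"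
        by (rule N.indep_vars_reindex_inj) simp
      then have \<eta>_indep: "N.indep_vars (\<lambda>_. borel) (\<lambda>m \<omega>. varsigma *\<^sub>R \<eta> (Suc m) \<omega>) {2..}"
        by (rule N.indep_vars_compose2) auto
      have \<eta>_gauss: "iso_gaussian N (1 - \<beta>\<^sup>2) (\<lambda>\<omega>. varsigma *\<^sub>R \<eta> (Suc m) \<omega>)" if "m \<ge> 2" for m
        using N.iso_gaussian_scale[of 1 "\<eta> (Suc m)" varsigma] \<eta> pos that
        by (simp add: iid_std_gaussian_def varsigma_square)
      interpret \<eta>: moving_average N 2 "\<lambda>m \<omega>. varsigma *\<^sub>R \<eta> (Suc m) \<omega>"
          "\<lambda>k \<omega>. (h/2 * varsigma) *\<^sub>R (\<eta> k \<omega> + \<eta> (k + 1) \<omega>)" "h/2" "1 - \<beta>\<^sup>2"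
        by unfold_locales
           (use \<eta>_indep \<eta>_gauss pos in \<open>auto simp: indep_seq_def scaleR_add_right\<close>)
      show "distr M (prod_borel {3..}) (joint {3..} \<zeta>) =
           distr N (prod_borel {3..})
             (joint {3..} (\<lambda>k \<omega>. (h/2 * varsigma) *\<^sub>R (\<eta> k \<omega> + \<eta> (k + 1) \<omega>)))"
        using chi.law \<eta>.law by simp
    qed
  qed
qed

end
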